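(* Let $\mathcal O=\left((2n_1+1)^{r_1}\cdots(2n_p+1)^{r_p}\right)$, with $n_1>\cdots>n_p\geqslant0$ and $r_i>0$ for all $i$, be a unipotent orbit of $\mathrm{SO}_{2k+1}$, let $l=r_1+\cdots+r_p$, and let $\mathcal O'=\left((2n_1+3)^{r_1}\cdots(2n_p+3)^{r_p}(1)\right)$. Suppose $(\pi,\mathcal V)$ is an irreducible cuspidal genuine automorphic representation of $\widetilde{\mathrm{SO}}_{2k+1}(\mathbb A)$ with $\mathcal O(\pi)=\mathcal O$ such that its theta lifting $\Theta(\pi)=\Theta_{4k+2l+3}(\pi)$ on $\widetilde{\mathrm{SO}}_{2k+2l+2}(\mathbb A)$ has $\mathcal O(\Theta(\pi))=\mathcal O'$. Then $$\dim(\mathrm{SO}_{2k+1})+\dim(\Theta(\pi))=\dim(\pi)+\dim(\Theta_{4k+2l+3}).$$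
   Context: $F$ is a number field containing the group $\mu_4$ of all fourth roots of unity, with ring of adeles $\mathbb A$. $\mathrm{SO}_m=\{g\in\mathrm{SL}_m:gJ_mg^T=J_m\}$, $J_m$ the anti-diagonal matrix of ones; $B=TN$ is the upper triangular Borel subgroup. $\widetilde{\mathrm{SO}}_m(\mathbb A)$ is the double cover of $\mathrm{SO}_m(\mathbb A)$ obtained by restricting to $\mathrm{SO}_m$ the metaplectic 4-fold cover of $\mathrm{SL}_m$ (Matsumoto, Kazhdan–Patterson); the square of the cocycle becomes essentially trivial on $\mathrm{SO}_m$. $\mathrm{SO}_m(F)$ and $N(\mathbb A)$ split in it and are identified with subgroups. **Theta representation and lifting.** For $s\in\mathbb C^m$ let $\chi_s$ be the character $\mathrm{diag}(t_1,\dots,t_m,1,t_m^{-1},\dots,t_1^{-1})\mapsto\prod|t_i|^{s_i}$ of $T(\mathbb A)\subset\mathrm{SO}_{2m+1}(\mathbb A)$, giving a genuine character of $Z(\widetilde T(F))\backslash Z(\widetilde T(\mathbb A))$, and $\mathrm{Ind}(\chi_s)$ the corresponding normalized principal series of $\widetilde{\mathrm{SO}}_{2m+1}(\mathbb A)$. For $f\in\mathrm{Ind}(\chi_{s_\theta})$, $s_\theta=(m/2,\dots,1/2)$, with smooth section $f_s$, let $E(g,f_s)=\sum_{\gamma\in B(F)\backslash\mathrm{SO}_{2m+1}(F)}f_s(\gamma g)$ (meromorphically continued); $\Theta_{2m+1}$ is spanned by the iterated residues $\mathrm{res}_{s_1=m/2}\cdots\mathrm{res}_{s_m=1/2}E(g,f_s)$.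 $(h,g)\in\mathrm{SO}_{2k'}\times\mathrm{SO}_{2k+1}$, $h=\begin{pmatrix}a&b\\c&d\end{pmatrix}$, is identified with $\begin{pmatrix}a&0&b\\0&g&0\\c&0&d\end{pmatrix}\in\mathrm{SO}_{2k+2k'+1}$ (covered by an embedding of covers), and $\Theta_{2k+2k'+1}(\pi)$ is the automorphic representation of $\widetilde{\mathrm{SO}}_{2k'}(\mathbb A)$ generated by the functions $h\mapsto\int_{\mathrm{SO}_{2k+1}(F)\backslash\mathrm{SO}_{2k+1}(\mathbb A)}\varphi(g)\overline{\theta(h,g)}\,dg$, $\varphi\in\mathcal V$, $\theta\in\Theta_{2k+2k'+1}$; here $k'=k+l+1$. **Orbits and wave front set.** Unipotent orbits are parametrized by partitions in which even parts occur with even multiplicity. For partitions $\mathcal O_1=(p_1p_2\cdots p_r)$ and $\mathcal O_2=(q_1q_2\cdots q_s)$, $\mathcal O_1\geqslant\mathcal O_2$ if $p_1+\cdots+p_i\geqslant q_1+\cdots+q_i$ for all $1\leqslant i\leqslant s$. For $\mathcal O=(p_1^{e_1}\cdots p_q^{e_q})$, $h_{\mathcal O}(t)$ is obtained by collecting $e_i$ copies of $\mathrm{diag}(t^{p_i-1},t^{p_i-3},\dots,t^{1-p_i})$ for each $i$, rearranged with non-increasing powers of $t$; $V_{i,\mathcal O}\subset N$ is generated by the root subgroups with $h_{\mathcal O}(t)x_\alpha(r)h_{\mathcal O}(t)^{-1}=x_\alpha(t^jr)$, $j\geqslant i$; $M(\mathcal O)$ is generated by $T$ and the root subgroups commuting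 with $h_{\mathcal O}(t)$. A character of $V_{2,\mathcal O}(F)\backslash V_{2,\mathcal O}(\mathbb A)$ is generic if the connected component of its stabilizer in $M(\mathcal O)(F)$ has the same Cartan type as the stabilizer, over $\bar F$, of a point in the dense open $M(\mathcal O)$-orbit on $V_{2,\mathcal O}/[V_{2,\mathcal O},V_{2,\mathcal O}]$. $\mathcal O$ supports an automorphic representation $\rho$ if $\int_{V_{2,\mathcal O}(F)\backslash V_{2,\mathcal O}(\mathbb A)}\varphi(ug)\psi_{\mathcal O}(u)\,du\not\equiv0$ for some $\varphi$ in $\rho$ and some generic $\psi_{\mathcal O}$. The wave front set $\mathcal O(\rho)$ is the set of maximal orbits supporting $\rho$. **Dimension.** It is assumed that $\mathcal O(\rho)$ is a singleton for each automorphic representation $\rho$ considered, and it is identified with its unique element; the Gelfand–Kirillov dimension is $$\dim(\rho)=\tfrac12\dim(\mathcal O(\rho))=\dim(V_{2,\mathcal O(\rho)})+\tfrac12\dim(V_{1,\mathcal O(\rho)}/V_{2,\mathcal O(\rho)}).$$ It is known that $\mathcal O(\Theta_{2m+1})=(2^{m}1)$ if $m$ is even and $(2^{m-1}1^3)$ if $m$ is odd. $\dim(\mathrm{SO}_{2k+1})=2k^2+k$ is the dimension of the group. *)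

theory Defs
  imports
    "HOL-Complex_Analysis.Complex_Analysis"
    "HOL-Algebra.Algebra"
    "HOL-Algebra.Algebraic_Closure_Type"
    "HOL-Library.Function_Algebras"
    "HOL-Library.Multiset"
begin

(* In HOL-Algebra the letter X denotes the indeterminate of a polynomial ring. *)
no_notation var ("X\<index>")

section \<open>Number fields, places, completions, adeles\<close>

text \<open>The number field is the type \<open>'f\<close>; \<open>fring\<close> is a field type seen as a ring with carrier.\<close>

definition number_field :: "'f::field_char_0 itself \<Rightarrow> bool" where
  "number_field _ \<longleftrightarrow>
     (\<exists>B::'f set. finite B \<and> (\<forall>x. \<exists>c::'f \<Rightarrow> rat. x = (\<Sum>b\<in>B. of_rat (c b) * b)))"

abbreviation fring :: "'k::field ring" where
  "fring \<equiv> ring_of_type_algebra"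

definition mu4 :: "'f::field_char_0 set" where
  "mu4 = {x. x ^ 4 = 1}"

text \<open>
  A place is represented by its normalized absolute value.  For a finite place the value group is
  generated by \<open>q\<close>, the cardinality of the residue field; for a complex place the value is the square
  of the usual modulus.  There are no real places, since all number fields below contain a square
  root of \<open>-1\<close>.
\<close>

definition residue_card :: "('f::field_char_0 \<Rightarrow> real) \<Rightarrow> nat" where
  "residue_card v = card ({x. v x \<le> 1} // {(x, y). v x \<le> 1 \<and> v y \<le> 1 \<and> v (x - y) < 1})"

definition finite_place :: "('f::field_char_0 \<Rightarrow> real) \<Rightarrow> bool" where
  "finite_place v \<longleftrightarrow> v 0 = 0 \<and> (\<forall>x. x \<noteq> 0 \<longrightarrow> v x > 0) \<and> (\<forall>x y. v (x * y) = v x * v y) \<and>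
     (\<forall>x y. v (x + y) \<le> max (v x) (v y)) \<and>
     v ` (UNIV - {0}) = range (\<lambda>i::int. real (residue_card v) powi i)"

definition complex_place :: "('f::field_char_0 \<Rightarrow> real) \<Rightarrow> bool" where
  "complex_place v \<longleftrightarrow> (\<exists>\<sigma>::'f \<Rightarrow> complex. \<sigma> 1 = 1 \<and> (\<forall>x y. \<sigma> (x + y) = \<sigma> x + \<sigma> y) \<and>
     (\<forall>x y. \<sigma> (x * y) = \<sigma> x * \<sigma> y) \<and> v = (\<lambda>x. (cmod (\<sigma> x))\<^sup>2))"

definition places :: "('f::field_char_0 \<Rightarrow> real) set" where
  "places = {v. finite_place v \<or> complex_place v}"

text \<open>The completion at \<open>v\<close> is the ring of Cauchy sequences modulo null sequences.\<close>

definition cauchy_ring :: "('f::field_char_0 \<Rightarrow> real) \<Rightarrow> (nat \<Rightarrow> 'f) ring" where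
  "cauchy_ring v =
     \<lparr>carrier = {x. \<forall>\<epsilon>>0. \<exists>N. \<forall>i\<ge>N. \<forall>j\<ge>N. v (x i - x j) < \<epsilon>},
      monoid.mult = (\<lambda>x y n. x n * y n), one = (\<lambda>_. 1),
      ring.zero = (\<lambda>_. 0), add = (\<lambda>x y n. x n + y n)\<rparr>"

definition null_seqs :: "('f::field_char_0 \<Rightarrow> real) \<Rightarrow> (nat \<Rightarrow> 'f) set" where
  "null_seqs v = {x. (\<lambda>n. v (x n)) \<longlonglongrightarrow> 0}"

definition completion :: "('f::field_char_0 \<Rightarrow> real) \<Rightarrow> (nat \<Rightarrow> 'f) set ring" where
  "completion v = cauchy_ring v Quot null_seqs v"

definition to_completion :: "('f::field_char_0 \<Rightarrow> real) \<Rightarrow> 'f \<Rightarrow> (nat \<Rightarrow> 'f) set" where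
  "to_completion v x = null_seqs v +>\<^bsub>cauchy_ring v\<^esub> (\<lambda>_. x)"

definition cnorm :: "('f::field_char_0 \<Rightarrow> real) \<Rightarrow> (nat \<Rightarrow> 'f) set \<Rightarrow> real" where
  "cnorm v X = (THE r. \<forall>x\<in>X. (\<lambda>n. v (x n)) \<longlonglongrightarrow> r)"

type_synonym 'f adele = "('f \<Rightarrow> real) \<Rightarrow> (nat \<Rightarrow> 'f) set"

definition adeles :: "'f::field_char_0 adele ring" where
  "adeles =
     \<lparr>carrier = {a \<in> \<Pi>\<^sub>E v\<in>places. carrier (completion v).
                  finite {v. finite_place v \<and> cnorm v (a v) > 1}},
      monoid.mult = (\<lambda>a b. \<lambda>v\<in>places. a v \<otimes>\<^bsub>completion v\<^esub> b v),
      one = (\<lambda>v\<in>places. \<one>\<^bsub>completion v\<^esub>),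
      ring.zero = (\<lambda>v\<in>places. \<zero>\<^bsub>completion v\<^esub>),
      add = (\<lambda>a b. \<lambda>v\<in>places. a v \<oplus>\<^bsub>completion v\<^esub> b v)\<rparr>"

definition to_adele :: "'f::field_char_0 \<Rightarrow> 'f adele" where
  "to_adele x = (\<lambda>v\<in>places. to_completion v x)"

text \<open>Restricted product topology.\<close>

definition adele_top :: "'f::field_char_0 adele topology" where
  "adele_top = topology (\<lambda>U. U \<subseteq> carrier adeles \<and>
     (\<forall>a\<in>U. \<exists>S \<epsilon>. finite S \<and> S \<subseteq> places \<and> \<epsilon> > 0 \<and>
        {b \<in> carrier adeles.
           (\<forall>v\<in>S. cnorm v (b v \<ominus>\<^bsub>completion v\<^esub> a v) < \<epsilon>) \<and>
           (\<forall>v. finite_place v \<and> v \<notin> S \<longrightarrow> cnorm v (b v \<ominus>\<^bsub>completion v\<^esub> a v) \<le> 1)} \<subseteq> U))"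

definition anorm :: "'f::field_char_0 adele \<Rightarrow> real" where
  "anorm a = (\<Prod>v\<in>{v \<in> places. cnorm v (a v) \<noteq> 1}. cnorm v (a v))"

section \<open>Matrix groups\<close>

text \<open>
  An \<open>n \<times> n\<close> matrix over a ring \<open>R\<close> is indexed by \<open>1,\<dots>,n\<close> and is zero outside this range.
\<close>

type_synonym 'a sqmat = "nat \<Rightarrow> nat \<Rightarrow> 'a"

definition mat_of :: "nat \<Rightarrow> ('a, 'b) ring_scheme \<Rightarrow> (nat \<Rightarrow> nat \<Rightarrow> 'a) \<Rightarrow> 'a sqmat" where
  "mat_of n R f = (\<lambda>i j. if i \<in> {1..n} \<and> j \<in> {1..n} then f i j else \<zero>\<^bsub>R\<^esub>)"

definition mats :: "nat \<Rightarrow> ('a, 'b) ring_scheme \<Rightarrow> 'a sqmat set" where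
  "mats n R = {A. (\<forall>i\<in>{1..n}. \<forall>j\<in>{1..n}. A i j \<in> carrier R) \<and> A = mat_of n R A}"

definition mmul :: "nat \<Rightarrow> ('a, 'b) ring_scheme \<Rightarrow> 'a sqmat \<Rightarrow> 'a sqmat \<Rightarrow> 'a sqmat" where
  "mmul n R A B = mat_of n R (\<lambda>i j. finsum R (\<lambda>l. A i l \<otimes>\<^bsub>R\<^esub> B l j) {1..n})"

definition mone :: "nat \<Rightarrow> ('a, 'b) ring_scheme \<Rightarrow> 'a sqmat" where
  "mone n R = mat_of n R (\<lambda>i j. if i = j then \<one>\<^bsub>R\<^esub> else \<zero>\<^bsub>R\<^esub>)"

definition mtransp :: "'a sqmat \<Rightarrow> 'a sqmat" where
  "mtransp A = (\<lambda>i j. A j i)"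

definition mdet :: "nat \<Rightarrow> ('a, 'b) ring_scheme \<Rightarrow> 'a sqmat \<Rightarrow> 'a" where
  "mdet n R A = finsum R
     (\<lambda>p. (if evenperm p then \<one>\<^bsub>R\<^esub> else \<ominus>\<^bsub>R\<^esub> \<one>\<^bsub>R\<^esub>) \<otimes>\<^bsub>R\<^esub> finprod R (\<lambda>i. A i (p i)) {1..n})
     {p. p permutes {1..n}}"

definition antidiag :: "nat \<Rightarrow> ('a, 'b) ring_scheme \<Rightarrow> 'a sqmat" where
  "antidiag n R = mat_of n R (\<lambda>i j. if i + j = n + 1 then \<one>\<^bsub>R\<^esub> else \<zero>\<^bsub>R\<^esub>)"

definition SL :: "nat \<Rightarrow> ('a, 'b) ring_scheme \<Rightarrow> 'a sqmat set" where
  "SL n R = {A \<in> mats n R. mdet n R A = \<one>\<^bsub>R\<^esub>}"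

definition SO :: "nat \<Rightarrow> ('a, 'b) ring_scheme \<Rightarrow> 'a sqmat set" where
  "SO n R = {A \<in> SL n R. mmul n R (mmul n R A (antidiag n R)) (mtransp A) = antidiag n R}"

definition matgrp :: "nat \<Rightarrow> ('a, 'b) ring_scheme \<Rightarrow> 'a sqmat set \<Rightarrow> 'a sqmat monoid" where
  "matgrp n R S = \<lparr>carrier = S, monoid.mult = mmul n R, one = mone n R\<rparr>"

abbreviation SOg :: "nat \<Rightarrow> ('a, 'b) ring_scheme \<Rightarrow> 'a sqmat monoid" where
  "SOg n R \<equiv> matgrp n R (SO n R)"

definition mmap :: "('a \<Rightarrow> 'b) \<Rightarrow> 'a sqmat \<Rightarrow> 'b sqmat" where
  "mmap f A = (\<lambda>i j. f (A i j))"

text \<open>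
  Root subgroups of \<open>SO\<^sub>n\<close>.  Write \<open>a' = n + 1 - a\<close>.  The root vector attached to \<open>(a, b)\<close> is
  \<open>X = E\<^sub>a\<^sub>b - E\<^sub>b\<^sub>'\<^sub>a\<^sub>'\<close>, which satisfies \<open>X\<^sup>3 = 0\<close>, and \<open>so_root_elt n R a b r\<close> is
  \<open>exp (r X) = 1 + r X + r\<^sup>2 X\<^sup>2 / 2\<close>; the quadratic term is nonzero only if \<open>n\<close> is odd and \<open>a\<close> or \<open>b\<close>
  is the middle index.  The pairs \<open>(a, b)\<close> and \<open>(b', a')\<close> give the same root subgroup.
\<close>

definition so_roots :: "nat \<Rightarrow> (nat \<times> nat) set" where
  "so_roots n = {(a, b). a \<in> {1..n} \<and> b \<in> {1..n} \<and> a \<noteq> b \<and> a + b \<noteq> n + 1}"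

definition so_root_elt :: "nat \<Rightarrow> ('a, 'b) ring_scheme \<Rightarrow> nat \<Rightarrow> nat \<Rightarrow> 'a \<Rightarrow> 'a sqmat" where
  "so_root_elt n R a b r = (let a' = n + 1 - a; b' = n + 1 - b;
       h = \<ominus>\<^bsub>R\<^esub> (r \<otimes>\<^bsub>R\<^esub> r \<otimes>\<^bsub>R\<^esub> inv\<^bsub>R\<^esub> (\<one>\<^bsub>R\<^esub> \<oplus>\<^bsub>R\<^esub> \<one>\<^bsub>R\<^esub>)) in
     mat_of n R (\<lambda>i j.
       if i = j then \<one>\<^bsub>R\<^esub>
       else if (i, j) = (a, b) then r
       else if (i, j) = (b', a') then \<ominus>\<^bsub>R\<^esub> r
       else if b = b' \<and> (i, j) = (a, a') then h
       else if a = a' \<and> (i, j) = (b', b) then h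
       else \<zero>\<^bsub>R\<^esub>))"

definition so_root_subgroup :: "nat \<Rightarrow> ('a, 'b) ring_scheme \<Rightarrow> nat \<Rightarrow> nat \<Rightarrow> 'a sqmat set" where
  "so_root_subgroup n R a b = so_root_elt n R a b ` carrier R"

definition root_generated ::
    "nat \<Rightarrow> ('a, 'b) ring_scheme \<Rightarrow> (nat \<Rightarrow> nat \<Rightarrow> bool) \<Rightarrow> 'a sqmat set" where
  "root_generated n R P = generate (SOg n R)
     (\<Union>(a, b)\<in>{(a, b). (a, b) \<in> so_roots n \<and> P a b}. so_root_subgroup n R a b)"

definition so_borel :: "nat \<Rightarrow> ('a, 'b) ring_scheme \<Rightarrow> 'a sqmat set" where
  "so_borel n R = {A \<in> SO n R. \<forall>i\<in>{1..n}. \<forall>j\<in>{1..n}. j < i \<longrightarrow> A i j = \<zero>\<^bsub>R\<^esub>}"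

definition so_torus :: "nat \<Rightarrow> ('a, 'b) ring_scheme \<Rightarrow> 'a sqmat set" where
  "so_torus n R = {A \<in> SO n R. \<forall>i\<in>{1..n}. \<forall>j\<in>{1..n}. j \<noteq> i \<longrightarrow> A i j = \<zero>\<^bsub>R\<^esub>}"

definition so_unip :: "nat \<Rightarrow> ('a, 'b) ring_scheme \<Rightarrow> 'a sqmat set" where
  "so_unip n R = {A \<in> so_borel n R. \<forall>i\<in>{1..n}. A i i = \<one>\<^bsub>R\<^esub>}"

section \<open>Dimension and Lie algebra of a linear algebraic group\<close>

inductive_set polyfuns :: "nat \<Rightarrow> ('k::field sqmat \<Rightarrow> 'k) set" for n where
  const: "(\<lambda>_. c) \<in> polyfuns n"
| coord: "i \<in> {1..n} \<Longrightarrow> j \<in> {1..n} \<Longrightarrow> (\<lambda>A. A i j) \<in> polyfuns n"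
| add: "p \<in> polyfuns n \<Longrightarrow> q \<in> polyfuns n \<Longrightarrow> (\<lambda>A. p A + q A) \<in> polyfuns n"
| mult: "p \<in> polyfuns n \<Longrightarrow> q \<in> polyfuns n \<Longrightarrow> (\<lambda>A. p A * q A) \<in> polyfuns n"

text \<open>
  Tangent space at the identity of the Zariski closure of a matrix group \<open>S\<close>: all \<open>X\<close> such that the
  differential at \<open>1\<close> of every polynomial function vanishing on \<open>S\<close> is zero in the direction \<open>X\<close>.
\<close>

definition lie_alg :: "nat \<Rightarrow> 'k::field sqmat set \<Rightarrow> 'k sqmat set" where
  "lie_alg n S = {X \<in> mats n fring. \<forall>p\<in>polyfuns n. (\<forall>A\<in>S. p A = 0) \<longrightarrow>
     (\<forall>q. (\<forall>t. p (\<lambda>i j. mone n fring i j + t * X i j) = poly q t) \<longrightarrow> poly.coeff q 1 = 0)}"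

text \<open>
  In characteristic zero (the only case used) the dimension of an algebraic group is that of its
  Lie algebra; \<open>S\<close> is the group of points over an algebraically closed field.
\<close>

definition alg_dim :: "nat \<Rightarrow> 'k::field sqmat set \<Rightarrow> nat" where
  "alg_dim n S = vector_space.dim (\<lambda>c X i j. c * X i j) (lie_alg n S)"

definition lie_bracket :: "nat \<Rightarrow> 'k::field sqmat \<Rightarrow> 'k sqmat \<Rightarrow> 'k sqmat" where
  "lie_bracket n X Y = (\<lambda>i j. mmul n fring X Y i j - mmul n fring Y X i j)"

definition lie_isomorphic :: "nat \<Rightarrow> 'k::field sqmat set \<Rightarrow> 'k sqmat set \<Rightarrow> bool" where
  "lie_isomorphic n L L' \<longleftrightarrow> (\<exists>\<phi>. bij_betw \<phi> L L' \<and>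
     (\<forall>X\<in>L. \<forall>Y\<in>L. \<phi> (\<lambda>i j. X i j + Y i j) = (\<lambda>i j. \<phi> X i j + \<phi> Y i j)) \<and>
     (\<forall>X\<in>L. \<forall>c. \<phi> (\<lambda>i j. c * X i j) = (\<lambda>i j. c * \<phi> X i j)) \<and>
     (\<forall>X\<in>L. \<forall>Y\<in>L. \<phi> (lie_bracket n X Y) = lie_bracket n (\<phi> X) (\<phi> Y)))"

section \<open>Unipotent orbits\<close>

text \<open>Partitions are multisets of positive parts.\<close>

definition is_orbit :: "nat \<Rightarrow> nat multiset \<Rightarrow> bool" where
  "is_orbit n \<O> \<longleftrightarrow> sum_mset \<O> = n \<and> 0 \<notin># \<O> \<and> (\<forall>p. even p \<longrightarrow> even (count \<O> p))"

definition orbit_ge :: "nat multiset \<Rightarrow> nat multiset \<Rightarrow> bool" where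
  "orbit_ge P Q \<longleftrightarrow> (\<forall>i\<in>{1..size Q}.
     sum_list (take i (rev (sorted_list_of_multiset P))) \<ge>
     sum_list (take i (rev (sorted_list_of_multiset Q))))"

text \<open>
  \<open>hexp \<O> a\<close> is the exponent of \<open>t\<close> in the \<open>a\<close>-th diagonal entry of \<open>h\<^sub>\<O>(t)\<close>.  Conjugation by \<open>h\<^sub>\<O>(t)\<close>
  multiplies the parameter of the root subgroup of \<open>(a, b)\<close> by \<open>t\<close> to the power
  \<open>hexp \<O> a - hexp \<O> b\<close>.
\<close>

definition hexp :: "nat multiset \<Rightarrow> nat \<Rightarrow> int" where
  "hexp \<O> a = rev (sorted_list_of_multiset
     (\<Sum>p\<in>#\<O>. mset (map (\<lambda>j. int p - 1 - 2 * int j) [0..<p]))) ! (a - 1)"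

definition Vcond :: "nat multiset \<Rightarrow> int \<Rightarrow> nat \<Rightarrow> nat \<Rightarrow> bool" where
  "Vcond \<O> i a b \<longleftrightarrow> a < b \<and> hexp \<O> a - hexp \<O> b \<ge> i"

definition Vgrp :: "nat \<Rightarrow> ('a, 'b) ring_scheme \<Rightarrow> int \<Rightarrow> nat multiset \<Rightarrow> 'a sqmat set" where
  "Vgrp n R i \<O> = root_generated n R (Vcond \<O> i)"

definition Mgrp :: "nat \<Rightarrow> ('a, 'b) ring_scheme \<Rightarrow> nat multiset \<Rightarrow> 'a sqmat set" where
  "Mgrp n R \<O> = generate (SOg n R)
     (so_torus n R \<union> root_generated n R (\<lambda>a b. hexp \<O> a = hexp \<O> b))"

definition mconj :: "nat \<Rightarrow> ('a, 'b) ring_scheme \<Rightarrow> 'a sqmat \<Rightarrow> 'a sqmat \<Rightarrow> 'a sqmat" where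
  "mconj n R m u = mmul n R (mmul n R m u) (inv\<^bsub>SOg n R\<^esub> m)"

text \<open>
  \<open>u0\<close> represents a point of \<open>V\<^sub>2/[V\<^sub>2,V\<^sub>2]\<close> over the algebraically closed field \<open>'k\<close>; its orbit is
  described by its preimage in \<open>V\<^sub>2\<close>.
\<close>

definition orbit_preimage :: "nat \<Rightarrow> nat multiset \<Rightarrow> 'k::field sqmat \<Rightarrow> 'k sqmat set" where
  "orbit_preimage n \<O> u0 =
     {mmul n fring (mconj n fring m u0) w | m w.
        m \<in> Mgrp n fring \<O> \<and> w \<in> derived (SOg n fring) (Vgrp n fring 2 \<O>)}"

definition in_dense_open_orbit :: "nat \<Rightarrow> nat multiset \<Rightarrow> 'k::field sqmat \<Rightarrow> bool" where
  "in_dense_open_orbit n \<O> u0 \<longleftrightarrow> u0 \<in> Vgrp n fring 2 \<O> \<and>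
     (\<exists>P\<subseteq>polyfuns n. orbit_preimage n \<O> u0 = {u \<in> Vgrp n fring 2 \<O>. \<exists>p\<in>P. p u \<noteq> 0}) \<and>
     (\<forall>p\<in>polyfuns n. (\<forall>u\<in>orbit_preimage n \<O> u0. p u = 0) \<longrightarrow> (\<forall>u\<in>Vgrp n fring 2 \<O>. p u = 0))"

definition point_stabilizer :: "nat \<Rightarrow> nat multiset \<Rightarrow> 'k::field sqmat \<Rightarrow> 'k sqmat set" where
  "point_stabilizer n \<O> u0 = {m \<in> Mgrp n fring \<O>.
     mmul n fring (mconj n fring m u0) (inv\<^bsub>SOg n fring\<^esub> u0)
       \<in> derived (SOg n fring) (Vgrp n fring 2 \<O>)}"

section \<open>Metaplectic covers\<close>

text \<open>
  \<open>c v\<close> is the fourth power Hilbert symbol of the completion at \<open>v\<close>, with values in the fourth roots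
  of unity of the number field.  Away from \<open>2\<close> it is given by the tame formula; the dyadic symbols
  are then determined by continuity, bimultiplicativity and the reciprocity law.
\<close>

definition hilbert_symbols ::
    "(('f::field_char_0 \<Rightarrow> real) \<Rightarrow> (nat \<Rightarrow> 'f) set \<Rightarrow> (nat \<Rightarrow> 'f) set \<Rightarrow> 'f) \<Rightarrow> bool" where
  "hilbert_symbols c \<longleftrightarrow>
     (\<forall>v\<in>places. \<forall>x\<in>Units (completion v). \<forall>y\<in>Units (completion v).
        c v x y \<in> mu4 \<and>
        (\<forall>z\<in>Units (completion v). c v (x \<otimes>\<^bsub>completion v\<^esub> y) z = c v x z * c v y z \<and>
                                 c v z (x \<otimes>\<^bsub>completion v\<^esub> y) = c v z x * c v z y) \<and>
        (\<exists>\<epsilon>>0. \<forall>x'\<in>Units (completion v). \<forall>y'\<in>Units (completion v).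
           cnorm v (x' \<ominus>\<^bsub>completion v\<^esub> x) < \<epsilon> \<and> cnorm v (y' \<ominus>\<^bsub>completion v\<^esub> y) < \<epsilon> \<longrightarrow>
           c v x' y' = c v x y) \<and>
        (complex_place v \<longrightarrow> c v x y = 1) \<and>
        (finite_place v \<and> v 2 = 1 \<longrightarrow>
          (\<forall>a b::int. cnorm v x = real (residue_card v) powi (- a) \<and>
                      cnorm v y = real (residue_card v) powi (- b) \<longrightarrow>
             cnorm v (((\<ominus>\<^bsub>completion v\<^esub> \<one>\<^bsub>completion v\<^esub>) [^]\<^bsub>completion v\<^esub> (a * b)
                  \<otimes>\<^bsub>completion v\<^esub> x [^]\<^bsub>completion v\<^esub> b
                  \<otimes>\<^bsub>completion v\<^esub> y [^]\<^bsub>completion v\<^esub> (- a))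
                  [^]\<^bsub>completion v\<^esub> ((residue_card v - 1) div 4)
                \<ominus>\<^bsub>completion v\<^esub> to_completion v (c v x y)) < 1))) \<and>
     (\<forall>a b. a \<noteq> 0 \<and> b \<noteq> 0 \<longrightarrow>
        finite {v \<in> places. c v (to_completion v a) (to_completion v b) \<noteq> 1} \<and>
        (\<Prod>v\<in>{v \<in> places. c v (to_completion v a) (to_completion v b) \<noteq> 1}.
           c v (to_completion v a) (to_completion v b)) = 1)"

definition global_symbol ::
    "(('f::field_char_0 \<Rightarrow> real) \<Rightarrow> (nat \<Rightarrow> 'f) set \<Rightarrow> (nat \<Rightarrow> 'f) set \<Rightarrow> 'f) \<Rightarrow> 'f adele \<Rightarrow> 'f adele \<Rightarrow> 'f"
  where
  "global_symbol c x y = (\<Prod>v\<in>{v \<in> places. c v (x v) (y v) \<noteq> 1}. c v (x v) (y v))"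

definition sl_top :: "nat \<Rightarrow> 'f::field_char_0 adele sqmat topology" where
  "sl_top n = pullback_topology (SL n adeles)
     (\<lambda>A. \<lambda>ij\<in>{1..n} \<times> {1..n}. A (fst ij) (snd ij))
     (product_topology (\<lambda>_. adele_top) ({1..n} \<times> {1..n}))"

text \<open>
  The first fields describe the 4-fold cover of \<open>SL\<^sub>n(\<A>)\<close>: the group, its topology, the projection and
  the embedding of the fourth roots of unity.  The last field is the subset that forms the double
  cover of \<open>SO\<^sub>n(\<A>)\<close>.
\<close>

record ('f, 'g) metacover =
  mc_deg :: nat
  mc_grp :: "'g monoid"
  mc_top :: "'g topology"
  mc_proj :: "'g \<Rightarrow> 'f adele sqmat"
  mc_mu :: "'f \<Rightarrow> 'g"
  mc_so :: "'g set"

text \<open>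
  The splitting of the 4-fold cover over a subgroup \<open>U\<close> of \<open>SL\<^sub>n(\<A>)\<close>.  It is only used when \<open>U\<close> has no
  nontrivial homomorphism to a cyclic group of order 4, namely for adelic points of unipotent
  groups (divisible) and for the rational points of \<open>SL\<^sub>n\<close> (perfect), so that a splitting is unique.
\<close>

definition splitting ::
    "('f::field_char_0, 'g) metacover \<Rightarrow> 'f adele sqmat set \<Rightarrow> 'f adele sqmat \<Rightarrow> 'g" where
  "splitting C U = (THE s. s \<in> extensional U \<and> s \<in> hom (matgrp (mc_deg C) adeles U) (mc_grp C) \<and>
     (\<forall>u\<in>U. mc_proj C (s u) = u))"

definition rational_lift :: "('f::field_char_0, 'g) metacover \<Rightarrow> 'f sqmat \<Rightarrow> 'g" where
  "rational_lift C \<gamma> = splitting C (mmap to_adele ` SL (mc_deg C) fring) (mmap to_adele \<gamma>)"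

definition sl_root_elt :: "nat \<Rightarrow> ('a, 'b) ring_scheme \<Rightarrow> nat \<Rightarrow> nat \<Rightarrow> 'a \<Rightarrow> 'a sqmat" where
  "sl_root_elt n R a b r = mat_of n R (\<lambda>i j.
     if i = j then \<one>\<^bsub>R\<^esub> else if (i, j) = (a, b) then r else \<zero>\<^bsub>R\<^esub>)"

definition xlift :: "('f::field_char_0, 'g) metacover \<Rightarrow> nat \<Rightarrow> nat \<Rightarrow> 'f adele \<Rightarrow> 'g" where
  "xlift C a b r = splitting C (sl_root_elt (mc_deg C) adeles a b ` carrier adeles)
     (sl_root_elt (mc_deg C) adeles a b r)"

definition wlift :: "('f::field_char_0, 'g) metacover \<Rightarrow> nat \<Rightarrow> nat \<Rightarrow> 'f adele \<Rightarrow> 'g" where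
  "wlift C a b x = xlift C a b x \<otimes>\<^bsub>mc_grp C\<^esub> xlift C b a (\<ominus>\<^bsub>adeles\<^esub> (inv\<^bsub>adeles\<^esub> x))
     \<otimes>\<^bsub>mc_grp C\<^esub> xlift C a b x"

definition hlift :: "('f::field_char_0, 'g) metacover \<Rightarrow> nat \<Rightarrow> nat \<Rightarrow> 'f adele \<Rightarrow> 'g" where
  "hlift C a b x = wlift C a b x \<otimes>\<^bsub>mc_grp C\<^esub> wlift C a b (\<ominus>\<^bsub>adeles\<^esub> \<one>\<^bsub>adeles\<^esub>)"

text \<open>
  The metaplectic 4-fold cover of \<open>SL\<^sub>n(\<A>)\<close> is the topological central extension whose Matsumoto
  (Steinberg) symbol is the global 4-th power Hilbert symbol.
\<close>

definition metaplectic_SL_cover ::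
    "(('f::field_char_0 \<Rightarrow> real) \<Rightarrow> (nat \<Rightarrow> 'f) set \<Rightarrow> (nat \<Rightarrow> 'f) set \<Rightarrow> 'f) \<Rightarrow> ('f, 'g) metacover \<Rightarrow> bool"
  where
  "metaplectic_SL_cover c C \<longleftrightarrow> (let n = mc_deg C; G = mc_grp C in
     group G \<and> topspace (mc_top C) = carrier G \<and> Hausdorff_space (mc_top C) \<and>
     continuous_map (prod_topology (mc_top C) (mc_top C)) (mc_top C) (\<lambda>(x, y). x \<otimes>\<^bsub>G\<^esub> y) \<and>
     continuous_map (mc_top C) (mc_top C) (\<lambda>x. inv\<^bsub>G\<^esub> x) \<and>
     mc_proj C \<in> hom G (matgrp n adeles (SL n adeles)) \<and> mc_proj C ` carrier G = SL n adeles \<and>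
     continuous_map (mc_top C) (sl_top n) (mc_proj C) \<and>
     open_map (mc_top C) (sl_top n) (mc_proj C) \<and>
     inj_on (mc_mu C) mu4 \<and>
     (\<forall>x\<in>mu4. \<forall>y\<in>mu4. mc_mu C (x * y) = mc_mu C x \<otimes>\<^bsub>G\<^esub> mc_mu C y) \<and>
     mc_mu C ` mu4 = {g \<in> carrier G. mc_proj C g = mone n adeles} \<and>
     (\<forall>z\<in>mu4. \<forall>g\<in>carrier G. mc_mu C z \<otimes>\<^bsub>G\<^esub> g = g \<otimes>\<^bsub>G\<^esub> mc_mu C z) \<and>
     (\<forall>a\<in>{1..n}. \<forall>b\<in>{1..n}. a < b \<longrightarrow> (\<forall>x\<in>Units adeles. \<forall>y\<in>Units adeles.
        hlift C a b x \<otimes>\<^bsub>G\<^esub> hlift C a b y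
          = mc_mu C (global_symbol c x y) \<otimes>\<^bsub>G\<^esub> hlift C a b (x \<otimes>\<^bsub>adeles\<^esub> y))))"

text \<open>
  The restriction of the 4-fold cover to \<open>SO\<^sub>n(\<A>)\<close> has a cocycle whose square is a coboundary; it
  therefore reduces to an extension by \<open>{1, -1}\<close>, a closed subgroup which is the double cover and
  which contains the lifted rational points.
\<close>

definition so_double_cover ::
    "(('f::field_char_0 \<Rightarrow> real) \<Rightarrow> (nat \<Rightarrow> 'f) set \<Rightarrow> (nat \<Rightarrow> 'f) set \<Rightarrow> 'f) \<Rightarrow> ('f, 'g) metacover \<Rightarrow> bool"
  where
  "so_double_cover c C \<longleftrightarrow> metaplectic_SL_cover c C \<and>
     subgroup (mc_so C) (mc_grp C) \<and> closedin (mc_top C) (mc_so C) \<and>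
     mc_proj C ` mc_so C = SO (mc_deg C) adeles \<and>
     mc_so C \<inter> mc_mu C ` mu4 = mc_mu C ` {1, - 1} \<and>
     rational_lift C ` SO (mc_deg C) fring \<subseteq> mc_so C"

abbreviation cmult :: "('f, 'g) metacover \<Rightarrow> 'g \<Rightarrow> 'g \<Rightarrow> 'g" where
  "cmult C \<equiv> monoid.mult (mc_grp C)"

section \<open>Automorphic representations of the double covers\<close>

text \<open>
  Automorphic forms are functions on the double cover, extended by zero to the type \<open>'g\<close>.
\<close>

definition cspan :: "('g \<Rightarrow> complex) set \<Rightarrow> ('g \<Rightarrow> complex) set" where
  "cspan = module.span (\<lambda>c f g. c * f g)"

definition fin_dim :: "('g \<Rightarrow> complex) set \<Rightarrow> bool" where
  "fin_dim S \<longleftrightarrow> (\<exists>B. finite B \<and> S \<subseteq> cspan B)"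

definition rtrans :: "('f, 'g) metacover \<Rightarrow> 'g \<Rightarrow> ('g \<Rightarrow> complex) \<Rightarrow> 'g \<Rightarrow> complex" where
  "rtrans C h f = (\<lambda>g. if g \<in> mc_so C then f (cmult C g h) else 0)"

text \<open>
  The Lie algebra of the archimedean part is the set of continuous one-parameter subgroups of the
  double cover (these all lie over the archimedean component).
\<close>

definition one_param :: "('f, 'g) metacover \<Rightarrow> (real \<Rightarrow> 'g) set" where
  "one_param C = {c. continuous_map euclideanreal (subtopology (mc_top C) (mc_so C)) c \<and>
     (\<forall>s t. c (s + t) = cmult C (c s) (c t))}"

definition lie_deriv :: "('f, 'g) metacover \<Rightarrow> (real \<Rightarrow> 'g) \<Rightarrow> ('g \<Rightarrow> complex) \<Rightarrow> 'g \<Rightarrow> complex" where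
  "lie_deriv C c f = (\<lambda>g. if g \<in> mc_so C
     then vector_derivative (\<lambda>t. f (cmult C g (c t))) (at 0) else 0)"

definition arch_smooth :: "('f, 'g) metacover \<Rightarrow> ('g \<Rightarrow> complex) \<Rightarrow> bool" where
  "arch_smooth C f \<longleftrightarrow> (\<exists>S. f \<in> S \<and> (\<forall>\<phi>\<in>S. (\<forall>g. g \<notin> mc_so C \<longrightarrow> \<phi> g = 0) \<and>
     continuous_map (subtopology (mc_top C) (mc_so C)) euclidean \<phi> \<and>
     (\<forall>c\<in>one_param C. lie_deriv C c \<phi> \<in> S \<and>
        (\<forall>g\<in>mc_so C. (\<lambda>t. \<phi> (cmult C g (c t))) differentiable (at 0)))))"

definition finite_part :: "('f::field_char_0, 'g) metacover \<Rightarrow> 'g set" where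
  "finite_part C = {g \<in> mc_so C. \<forall>v. complex_place v \<longrightarrow>
     (\<forall>i\<in>{1..mc_deg C}. \<forall>j\<in>{1..mc_deg C}. mc_proj C g i j v = mone (mc_deg C) adeles i j v)}"

definition smooth_fun :: "('f::field_char_0, 'g) metacover \<Rightarrow> ('g \<Rightarrow> complex) \<Rightarrow> bool" where
  "smooth_fun C f \<longleftrightarrow> arch_smooth C f \<and>
     (\<exists>U. subgroup U (mc_grp C) \<and> openin (subtopology (mc_top C) (finite_part C)) U \<and>
          (\<forall>u\<in>U. rtrans C u f = f))"

text \<open>
  Standard maximal compact subgroup: integral at the finite places, and at the complex places the
  matrices preserving the standard Hermitian norm (recall that \<open>cnorm\<close> is the squared modulus there).
\<close>

definition max_compact :: "nat \<Rightarrow> 'f::field_char_0 adele sqmat set" where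
  "max_compact n = {A \<in> SO n adeles.
     (\<forall>v. finite_place v \<longrightarrow> (\<forall>i\<in>{1..n}. \<forall>j\<in>{1..n}. cnorm v (A i j v) \<le> 1)) \<and>
     (\<forall>v. complex_place v \<longrightarrow> (\<forall>x\<in>{1..n} \<rightarrow> carrier (completion v).
        (\<Sum>i=1..n. cnorm v (finsum (completion v) (\<lambda>j. A i j v \<otimes>\<^bsub>completion v\<^esub> x j) {1..n}))
          = (\<Sum>j=1..n. cnorm v (x j))))}"

definition cover_compact :: "('f::field_char_0, 'g) metacover \<Rightarrow> 'g set" where
  "cover_compact C = {g \<in> mc_so C. mc_proj C g \<in> max_compact (mc_deg C)}"

definition K_finite :: "('f::field_char_0, 'g) metacover \<Rightarrow> ('g \<Rightarrow> complex) \<Rightarrow> bool" where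
  "K_finite C f \<longleftrightarrow> fin_dim ((\<lambda>k. rtrans C k f) ` cover_compact C)"

text \<open>The enveloping algebra acts by the operators generated by \<open>lie_deriv\<close>.\<close>

inductive_set env_ops ::
    "('f, 'g) metacover \<Rightarrow> (('g \<Rightarrow> complex) \<Rightarrow> ('g \<Rightarrow> complex)) set" for C where
  scalar: "(\<lambda>f g. a * f g) \<in> env_ops C"
| deriv: "c \<in> one_param C \<Longrightarrow> lie_deriv C c \<in> env_ops C"
| add: "P \<in> env_ops C \<Longrightarrow> Q \<in> env_ops C \<Longrightarrow> (\<lambda>f g. P f g + Q f g) \<in> env_ops C"
| comp: "P \<in> env_ops C \<Longrightarrow> Q \<in> env_ops C \<Longrightarrow> P \<circ> Q \<in> env_ops C"

definition env_center :: "('f, 'g) metacover \<Rightarrow> (('g \<Rightarrow> complex) \<Rightarrow> ('g \<Rightarrow> complex)) set" where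
  "env_center C = {Z \<in> env_ops C. \<forall>c\<in>one_param C. \<forall>f. arch_smooth C f \<longrightarrow>
     Z (lie_deriv C c f) = lie_deriv C c (Z f)}"

definition adelic_height :: "nat \<Rightarrow> 'f::field_char_0 adele sqmat \<Rightarrow> real" where
  "adelic_height n A =
     (\<Prod>v\<in>{v \<in> places. \<exists>i\<in>{1..n}. \<exists>j\<in>{1..n}. cnorm v (A i j v) > 1}.
        Max ((\<lambda>(i, j). cnorm v (A i j v)) ` ({1..n} \<times> {1..n})))"

definition automorphic_form :: "('f::field_char_0, 'g) metacover \<Rightarrow> ('g \<Rightarrow> complex) \<Rightarrow> bool" where
  "automorphic_form C f \<longleftrightarrow> smooth_fun C f \<and>
     (\<forall>\<gamma>\<in>SO (mc_deg C) fring. \<forall>g\<in>mc_so C. f (cmult C (rational_lift C \<gamma>) g) = f g) \<and>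
     K_finite C f \<and> fin_dim ((\<lambda>Z. Z f) ` env_center C) \<and>
     (\<exists>a b. \<forall>g\<in>mc_so C. cmod (f g) \<le> a * adelic_height (mc_deg C) (mc_proj C g) powr b)"

text \<open>
  Subspaces stable under \<open>K\<close>, the finite adelic points and the archimedean Lie algebra.
\<close>

definition invariant_space :: "('f::field_char_0, 'g) metacover \<Rightarrow> ('g \<Rightarrow> complex) set \<Rightarrow> bool" where
  "invariant_space C W \<longleftrightarrow> cspan W = W \<and> (\<forall>f\<in>W.
     (\<forall>k\<in>cover_compact C \<union> finite_part C. rtrans C k f \<in> W) \<and>
     (\<forall>c\<in>one_param C. lie_deriv C c f \<in> W))"

definition generated_rep :: "('f::field_char_0, 'g) metacover \<Rightarrow> ('g \<Rightarrow> complex) set \<Rightarrow> ('g \<Rightarrow> complex) set"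
  where
  "generated_rep C S = \<Inter>{W. invariant_space C W \<and> S \<subseteq> W}"

definition automorphic_rep :: "('f::field_char_0, 'g) metacover \<Rightarrow> ('g \<Rightarrow> complex) set \<Rightarrow> bool" where
  "automorphic_rep C \<rho> \<longleftrightarrow> invariant_space C \<rho> \<and> (\<forall>f\<in>\<rho>. automorphic_form C f)"

definition irreducible_rep :: "('f::field_char_0, 'g) metacover \<Rightarrow> ('g \<Rightarrow> complex) set \<Rightarrow> bool" where
  "irreducible_rep C \<rho> \<longleftrightarrow> \<rho> \<noteq> {\<lambda>_. 0} \<and>
     (\<forall>W. invariant_space C W \<and> W \<subseteq> \<rho> \<longrightarrow> W = {\<lambda>_. 0} \<or> W = \<rho>)"

definition genuine_rep :: "('f::field_char_0, 'g) metacover \<Rightarrow> ('g \<Rightarrow> complex) set \<Rightarrow> bool" where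
  "genuine_rep C \<rho> \<longleftrightarrow> (\<forall>f\<in>\<rho>. \<forall>g\<in>mc_so C. f (cmult C (mc_mu C (- 1)) g) = - f g)"

text \<open>
  Integration over \<open>\<Gamma>\G\<close>, realized as the set of right cosets, against a nonzero right invariant Radon
  measure.  The measure is unique up to a positive scalar, on which nothing below depends.
\<close>

definition invariant_quot_measure ::
    "'a monoid \<Rightarrow> 'a topology \<Rightarrow> 'a set \<Rightarrow> 'a set measure \<Rightarrow> bool" where
  "invariant_quot_measure G T \<Gamma> \<mu> \<longleftrightarrow>
     space \<mu> = rcosets\<^bsub>G\<^esub> \<Gamma> \<and>
     sets \<mu> = sigma_sets (rcosets\<^bsub>G\<^esub> \<Gamma>) {Q. Q \<subseteq> rcosets\<^bsub>G\<^esub> \<Gamma> \<and> openin T (\<Union>Q)} \<and>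
     (\<forall>Q\<in>sets \<mu>. \<forall>g\<in>carrier G. emeasure \<mu> ((\<lambda>X. X #>\<^bsub>G\<^esub> g) ` Q) = emeasure \<mu> Q) \<and>
     (\<forall>K. compactin T K \<longrightarrow> emeasure \<mu> ((\<lambda>k. \<Gamma> #>\<^bsub>G\<^esub> k) ` K) < \<infinity>) \<and>
     emeasure \<mu> (space \<mu>) \<noteq> 0"

definition quot_integral ::
    "'a monoid \<Rightarrow> 'a topology \<Rightarrow> 'a set \<Rightarrow> ('a \<Rightarrow> complex) \<Rightarrow> complex" where
  "quot_integral G T \<Gamma> f =
     integral\<^sup>L (SOME \<mu>. invariant_quot_measure G T \<Gamma> \<mu>) (\<lambda>X. the_elem (f ` X))"

definition unipotent_integral ::
    "('f::field_char_0, 'g) metacover \<Rightarrow> (nat \<Rightarrow> nat \<Rightarrow> bool) \<Rightarrow> ('f adele sqmat \<Rightarrow> complex)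
       \<Rightarrow> ('g \<Rightarrow> complex) \<Rightarrow> 'g \<Rightarrow> complex" where
  "unipotent_integral C P \<psi> \<phi> g = (let n = mc_deg C; U = root_generated n adeles P in
     quot_integral (matgrp n adeles U) (subtopology (sl_top n) U)
       (mmap to_adele ` root_generated n fring P)
       (\<lambda>u. \<phi> (cmult C (splitting C U u) g) * \<psi> u))"

text \<open>
  The cocharacter with exponents \<open>\<nu>\<close> defines a parabolic subgroup containing \<open>T\<close>, with unipotent
  radical generated by the root subgroups of positive weight; up to rational conjugacy all parabolic
  subgroups arise in this way, and the parabolic is proper iff such a root exists.
\<close>

definition cuspidal_rep :: "('f::field_char_0, 'g) metacover \<Rightarrow> ('g \<Rightarrow> complex) set \<Rightarrow> bool" where
  "cuspidal_rep C \<rho> \<longleftrightarrow> (\<forall>\<phi>\<in>\<rho>. \<forall>\<nu>::nat \<Rightarrow> int.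
     (\<forall>a\<in>{1..mc_deg C}. \<nu> (mc_deg C + 1 - a) = - \<nu> a) \<and>
     (\<exists>(a, b)\<in>so_roots (mc_deg C). \<nu> a > \<nu> b) \<longrightarrow>
     (\<forall>g\<in>mc_so C. unipotent_integral C (\<lambda>a b. \<nu> a > \<nu> b) (\<lambda>_. 1) \<phi> g = 0))"

section \<open>Wave front set and Gelfand-Kirillov dimension\<close>

definition automorphic_character ::
    "nat \<Rightarrow> nat multiset \<Rightarrow> ('f::field_char_0 adele sqmat \<Rightarrow> complex) \<Rightarrow> bool" where
  "automorphic_character n \<O> \<psi> \<longleftrightarrow>
     (\<forall>u\<in>Vgrp n adeles 2 \<O>. cmod (\<psi> u) = 1) \<and>
     (\<forall>u\<in>Vgrp n adeles 2 \<O>. \<forall>w\<in>Vgrp n adeles 2 \<O>. \<psi> (mmul n adeles u w) = \<psi> u * \<psi> w) \<and>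
     (\<forall>u\<in>Vgrp n fring 2 \<O>. \<psi> (mmap to_adele u) = 1) \<and>
     continuous_map (subtopology (sl_top n) (Vgrp n adeles 2 \<O>)) euclidean \<psi>"

definition char_stabilizer ::
    "nat \<Rightarrow> nat multiset \<Rightarrow> ('f::field_char_0 adele sqmat \<Rightarrow> complex) \<Rightarrow> 'f sqmat set" where
  "char_stabilizer n \<O> \<psi> = {m \<in> Mgrp n fring \<O>. \<forall>u\<in>Vgrp n adeles 2 \<O>.
     \<psi> (mconj n adeles (mmap to_adele m) u) = \<psi> u}"

text \<open>
  Two stabilizers have identity components of the same Cartan type iff their Lie algebras become
  isomorphic over the algebraic closure.  Over an infinite perfect field the rational points of a
  connected linear group are Zariski dense, so \<open>lie_alg\<close> of the rational points of the stabilizer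
  is the Lie algebra of its identity component.
\<close>

definition generic_character ::
    "nat \<Rightarrow> nat multiset \<Rightarrow> ('f::field_char_0 adele sqmat \<Rightarrow> complex) \<Rightarrow> bool" where
  "generic_character n \<O> \<psi> \<longleftrightarrow> automorphic_character n \<O> \<psi> \<and>
     (\<exists>u0::'f alg_closure sqmat. in_dense_open_orbit n \<O> u0 \<and>
        lie_isomorphic n (lie_alg n (mmap to_ac ` char_stabilizer n \<O> \<psi>))
                         (lie_alg n (point_stabilizer n \<O> u0)))"

definition supports ::
    "('f::field_char_0, 'g) metacover \<Rightarrow> ('g \<Rightarrow> complex) set \<Rightarrow> nat multiset \<Rightarrow> bool" where
  "supports C \<rho> \<O> \<longleftrightarrow> (\<exists>\<phi>\<in>\<rho>. \<exists>\<psi>. generic_character (mc_deg C) \<O> \<psi> \<and>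
     (\<exists>g\<in>mc_so C. unipotent_integral C (Vcond \<O> 2) \<psi> \<phi> g \<noteq> 0))"

definition wave_front_set ::
    "('f::field_char_0, 'g) metacover \<Rightarrow> ('g \<Rightarrow> complex) set \<Rightarrow> nat multiset set" where
  "wave_front_set C \<rho> = {\<O>. is_orbit (mc_deg C) \<O> \<and> supports C \<rho> \<O> \<and>
     (\<forall>\<O>'. is_orbit (mc_deg C) \<O>' \<and> supports C \<rho> \<O>' \<and> orbit_ge \<O>' \<O> \<longrightarrow> \<O>' = \<O>)}"

text \<open>Meaningful only when the wave front set is a singleton.\<close>

definition gk_dim :: "('f::field_char_0, 'g) metacover \<Rightarrow> ('g \<Rightarrow> complex) set \<Rightarrow> real" where
  "gk_dim C \<rho> = (let n = mc_deg C; \<O> = the_elem (wave_front_set C \<rho>);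
       d = (\<lambda>i. real (alg_dim n (Vgrp n (fring :: 'f alg_closure ring) i \<O>))) in
     d 2 + (d 1 - d 2) / 2)"

definition dim_SO :: "'f::field_char_0 itself \<Rightarrow> nat \<Rightarrow> nat" where
  "dim_SO _ n = alg_dim n (SO n (fring :: 'f alg_closure ring))"

section \<open>Theta representations\<close>

text \<open>In this section \<open>mc_deg C = 2 * m + 1\<close>.\<close>

definition cover_torus_center :: "('f::field_char_0, 'g) metacover \<Rightarrow> 'g set" where
  "cover_torus_center C = (let T = {t \<in> mc_so C. mc_proj C t \<in> so_torus (mc_deg C) adeles} in
     {z \<in> T. \<forall>t\<in>T. cmult C z t = cmult C t z})"

text \<open>
  The projection of the center of the torus consists of the \<open>t\<close> whose entries are squares of ideles.
  There the Hilbert symbol vanishes, so the coroot lifts of \<open>t\<^sub>1,\<dots>,t\<^sub>m\<close> multiply to a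
  canonical homomorphic lift of \<open>t\<close>; the genuine character takes \<open>\<plusminus>\<close> this lift to \<open>\<plusminus>\<chi>\<^sub>s(t)\<close>.
\<close>

definition torus_lift :: "('f::field_char_0, 'g) metacover \<Rightarrow> nat \<Rightarrow> 'f adele sqmat \<Rightarrow> 'g" where
  "torus_lift C m t = foldr (\<lambda>i. cmult C (hlift C i (2 * m + 2 - i) (t i i))) [1..<m + 1] \<one>\<^bsub>mc_grp C\<^esub>"

definition chi :: "nat \<Rightarrow> (nat \<Rightarrow> complex) \<Rightarrow> 'f::field_char_0 adele sqmat \<Rightarrow> complex" where
  "chi m s t = (\<Prod>i=1..m. complex_of_real (anorm (t i i)) powr s i)"

definition genuine_chi ::
    "('f::field_char_0, 'g) metacover \<Rightarrow> nat \<Rightarrow> (nat \<Rightarrow> complex) \<Rightarrow> 'g \<Rightarrow> complex" where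
  "genuine_chi C m s z = (let t = mc_proj C z in
     (if z = torus_lift C m t then 1 else - 1) * chi m s t)"

text \<open>Square root of the modulus character of the Borel subgroup.\<close>

definition delta_half :: "nat \<Rightarrow> 'f::field_char_0 adele sqmat \<Rightarrow> real" where
  "delta_half m t = (\<Prod>i=1..m. anorm (t i i) powr (real (2 * (m - i) + 1) / 2))"

text \<open>
  Functions on the double cover induced from the maximal abelian subgroup \<open>T(F) Z(T)\<close> of the cover of
  the torus, where the inducing character is \<open>genuine_chi\<close> on the center and trivial on \<open>T(F)\<close>.
\<close>

definition principal_series ::
    "('f::field_char_0, 'g) metacover \<Rightarrow> nat \<Rightarrow> (nat \<Rightarrow> complex) \<Rightarrow> ('g \<Rightarrow> complex) set" where
  "principal_series C m s = {f. smooth_fun C f \<and> K_finite C f \<and> (\<forall>g\<in>mc_so C.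
     (\<forall>u\<in>so_unip (mc_deg C) adeles. f (cmult C (splitting C (so_unip (mc_deg C) adeles) u) g) = f g) \<and>
     (\<forall>t\<in>so_torus (mc_deg C) fring. f (cmult C (rational_lift C t) g) = f g) \<and>
     (\<forall>z\<in>cover_torus_center C.
        f (cmult C z g) = genuine_chi C m s z * of_real (delta_half m (mc_proj C z)) * f g))}"

text \<open>Absolute value of the \<open>i\<close>-th torus coordinate in the Iwasawa decomposition.\<close>

definition iwasawa :: "('f::field_char_0, 'g) metacover \<Rightarrow> nat \<Rightarrow> 'g \<Rightarrow> real" where
  "iwasawa C i g = (THE r. \<exists>u\<in>so_unip (mc_deg C) adeles. \<exists>t\<in>so_torus (mc_deg C) adeles.
     \<exists>k\<in>max_compact (mc_deg C).
       mc_proj C g = mmul (mc_deg C) adeles (mmul (mc_deg C) adeles u t) k \<and> r = anorm (t i i))"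

definition s_theta :: "nat \<Rightarrow> nat \<Rightarrow> complex" where
  "s_theta m i = of_nat (m + 1 - i) / 2"

text \<open>The standard section through \<open>f\<close>, which is an element of the principal series at \<open>s_theta m\<close>.\<close>

definition std_section ::
    "('f::field_char_0, 'g) metacover \<Rightarrow> nat \<Rightarrow> ('g \<Rightarrow> complex) \<Rightarrow> (nat \<Rightarrow> complex) \<Rightarrow> 'g \<Rightarrow> complex" where
  "std_section C m f s g =
     f g * (\<Prod>i=1..m. complex_of_real (iwasawa C i g) powr (s i - s_theta m i))"

definition eisenstein_term ::
    "('f::field_char_0, 'g) metacover \<Rightarrow> nat \<Rightarrow> ('g \<Rightarrow> complex) \<Rightarrow> 'g \<Rightarrow> (nat \<Rightarrow> complex) \<Rightarrow> 'f sqmat set \<Rightarrow> complex"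
  where
  "eisenstein_term C m f g s X =
     the_elem ((\<lambda>\<gamma>. std_section C m f s (cmult C (rational_lift C \<gamma>) g)) ` X)"

text \<open>
  Functions of \<open>s\<^sub>1,\<dots>,s\<^sub>m\<close> are functions on complex sequences depending on these coordinates only.
\<close>

definition holo_several :: "nat \<Rightarrow> (nat \<Rightarrow> complex) set \<Rightarrow> ((nat \<Rightarrow> complex) \<Rightarrow> complex) \<Rightarrow> bool" where
  "holo_several m U p \<longleftrightarrow> continuous_on U p \<and>
     (\<forall>s t. (\<forall>i\<in>{1..m}. s i = t i) \<longrightarrow> p s = p t) \<and>
     (\<forall>s\<in>U. \<forall>i\<in>{1..m}. (\<lambda>z. p (s(i := z))) field_differentiable at (s i))"

definition mero_several :: "nat \<Rightarrow> ((nat \<Rightarrow> complex) \<Rightarrow> complex) \<Rightarrow> bool" where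
  "mero_several m M \<longleftrightarrow> (\<forall>s t. (\<forall>i\<in>{1..m}. s i = t i) \<longrightarrow> M s = M t) \<and>
     (\<forall>s0. \<exists>U p q. open U \<and> s0 \<in> U \<and> holo_several m U p \<and> holo_several m U q \<and>
        interior {s \<in> U. q s = 0} = {} \<and> (\<forall>s\<in>U. q s \<noteq> 0 \<longrightarrow> M s = p s / q s))"

definition eisenstein_continuation ::
    "('f::field_char_0, 'g) metacover \<Rightarrow> nat \<Rightarrow> ('g \<Rightarrow> complex) \<Rightarrow> 'g \<Rightarrow> ((nat \<Rightarrow> complex) \<Rightarrow> complex) \<Rightarrow> bool"
  where
  "eisenstein_continuation C m f g M \<longleftrightarrow> mero_several m M \<and>
     (\<exists>b. \<forall>s. (\<forall>i\<in>{1..<m}. Re (s i) - Re (s (i + 1)) > b) \<and> (m \<ge> 1 \<longrightarrow> Re (s m) > b) \<longrightarrow>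
        (eisenstein_term C m f g s has_sum M s)
          (rcosets\<^bsub>SOg (mc_deg C) fring\<^esub> so_borel (mc_deg C) fring))"

text \<open>
  \<open>iterated_res m j M\<close> takes residues in \<open>s\<^sub>m\<close> at \<open>1/2\<close>, then \<open>s\<^sub>m\<^sub>-\<^sub>1\<close> at \<open>1\<close>, and so on, \<open>j\<close> times.
\<close>

primrec iterated_res ::
    "nat \<Rightarrow> nat \<Rightarrow> ((nat \<Rightarrow> complex) \<Rightarrow> complex) \<Rightarrow> (nat \<Rightarrow> complex) \<Rightarrow> complex" where
  "iterated_res m 0 M s = M s"
| "iterated_res m (Suc j) M s =
     residue (\<lambda>z. iterated_res m j M (s(m - j := z))) (s_theta m (m - j))"

definition theta_rep :: "('f::field_char_0, 'g) metacover \<Rightarrow> ('g \<Rightarrow> complex) set" where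
  "theta_rep C = (let m = mc_deg C div 2 in
     cspan {\<lambda>g. if g \<in> mc_so C then iterated_res m m (M g) (s_theta m) else 0 | f M.
       f \<in> principal_series C m (s_theta m) \<and>
       (\<forall>g\<in>mc_so C. eisenstein_continuation C m f g (M g))})"

section \<open>Theta lifting\<close>

text \<open>
  The matrix of \<open>(h, g)\<close>, with \<open>h\<close> of size \<open>2 * k'\<close> divided into four square blocks and \<open>g\<close> of size \<open>q\<close>
  in the middle.
\<close>

definition block_embed :: "nat \<Rightarrow> nat \<Rightarrow> ('a, 'b) ring_scheme \<Rightarrow> 'a sqmat \<Rightarrow> 'a sqmat \<Rightarrow> 'a sqmat" where
  "block_embed k' q R h g = mat_of (2 * k' + q) R (\<lambda>i j.
     let mid = (\<lambda>x. k' < x \<and> x \<le> k' + q); out = (\<lambda>x. if x \<le> k' then x else x - q) in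
     if mid i \<and> mid j then g (i - k') (j - k')
     else if \<not> mid i \<and> \<not> mid j then h (out i) (out j)
     else \<zero>\<^bsub>R\<^esub>)"

text \<open>
  The embedding of covers is the restriction of one of the 4-fold covers of special linear groups,
  which is unique because these groups are perfect.
\<close>

definition cover_embedding ::
    "('f::field_char_0, 'g) metacover \<Rightarrow> ('f, 'g) metacover \<Rightarrow> ('f, 'g) metacover \<Rightarrow> ('g \<Rightarrow> 'g \<Rightarrow> 'g) \<Rightarrow> bool"
  where
  "cover_embedding C1 C2 C3 \<iota> \<longleftrightarrow>
     continuous_map (prod_topology (mc_top C1) (mc_top C2)) (mc_top C3) (\<lambda>(h, g). \<iota> h g) \<and>
     (\<forall>h\<in>carrier (mc_grp C1). \<forall>g\<in>carrier (mc_grp C2).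
        mc_proj C3 (\<iota> h g)
          = block_embed (mc_deg C1 div 2) (mc_deg C2) adeles (mc_proj C1 h) (mc_proj C2 g) \<and>
        (\<forall>h'\<in>carrier (mc_grp C1). \<forall>g'\<in>carrier (mc_grp C2).
           \<iota> (cmult C1 h h') (cmult C2 g g') = cmult C3 (\<iota> h g) (\<iota> h' g'))) \<and>
     (\<forall>z\<in>mu4. \<iota> (mc_mu C1 z) \<one>\<^bsub>mc_grp C2\<^esub> = mc_mu C3 z \<and>
              \<iota> \<one>\<^bsub>mc_grp C1\<^esub> (mc_mu C2 z) = mc_mu C3 z) \<and>
     (\<forall>h\<in>mc_so C1. \<forall>g\<in>mc_so C2. \<iota> h g \<in> mc_so C3)"

text \<open>
  The integrand descends to \<open>SO(\<A>)\<close>, since both factors are genuine; it is evaluated at any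
  preimage in the double cover.
\<close>

definition theta_integral ::
    "('f::field_char_0, 'g) metacover \<Rightarrow> ('f, 'g) metacover \<Rightarrow> ('g \<Rightarrow> 'g \<Rightarrow> 'g)
       \<Rightarrow> ('g \<Rightarrow> complex) \<Rightarrow> ('g \<Rightarrow> complex) \<Rightarrow> 'g \<Rightarrow> complex" where
  "theta_integral C1 C2 \<iota> \<phi> \<theta> h = (let n = mc_deg C2 in
     if h \<in> mc_so C1 then
       quot_integral (SOg n adeles) (subtopology (sl_top n) (SO n adeles)) (mmap to_adele ` SO n fring)
         (\<lambda>x. the_elem ((\<lambda>g. \<phi> g * cnj (\<theta> (\<iota> h g))) ` {g \<in> mc_so C2. mc_proj C2 g = x}))
     else 0)"

definition theta_lift ::
    "('f::field_char_0, 'g) metacover \<Rightarrow> ('f, 'g) metacover \<Rightarrow> ('f, 'g) metacover \<Rightarrow> ('g \<Rightarrow> 'g \<Rightarrow> 'g)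
       \<Rightarrow> ('g \<Rightarrow> complex) set \<Rightarrow> ('g \<Rightarrow> complex) set" where
  "theta_lift C1 C2 C3 \<iota> \<V> = generated_rep C1
     {theta_integral C1 C2 \<iota> \<phi> \<theta> | \<phi> \<theta>. \<phi> \<in> \<V> \<and> \<theta> \<in> theta_rep C3}"

text \<open>The (known) wave front orbit of the theta representation of the cover of \<open>SO\<^sub>2\<^sub>m\<^sub>+\<^sub>1\<close>.\<close>

definition theta_orbit :: "nat \<Rightarrow> nat multiset" where
  "theta_orbit m = (if even m then replicate_mset m 2 + {#1#}
                    else replicate_mset (m - 1) 2 + replicate_mset 3 1)"

end

theory Submission
  imports Defs
begin

text \<open>
  The wave front sets are given as singletons, so each Gelfand--Kirillov dimension depends on one
  partition, and the identity compares dimensions of algebraic groups: those of the groups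
  \<open>V\<^sub>1\<close> and \<open>V\<^sub>2\<close> attached to the three partitions, and of the odd orthogonal group.

  Dimensions are dimensions of tangent spaces at the identity. For a subgroup of the orthogonal
  group, differentiating the defining equations shows that tangent vectors are skew under reflection
  in the antidiagonal and vanish where the group agrees with the identity; velocities of
  curves in root subgroups and in the torus show that nothing else is imposed. Hence
  (\<open>alg_dim_SO\<close>, \<open>alg_dim_root_generated\<close>) the dimension is the number of admissible matrix positions
  above the antidiagonal.

  For \<open>V\<^sub>c\<close> a position \<open>(a, b)\<close> is admissible when the \<open>a\<close>-th and \<open>b\<close>-th exponents of
  \<open>h\<^sub>\<O>(t)\<close> differ by at least \<open>c\<close>. Since these exponents are symmetric about \<open>0\<close>, the
  number of such positions is determined by counting ordered pairs in the multiset of exponents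
  (\<open>alg_dim_Vgrp\<close>).

  When all \<open>l\<close> parts are odd, this multiset is \<open>P\<close>, \<open>l\<close> zeros and \<open>- P\<close>, with even
  elements of \<open>P\<close>. Adding \<open>2\<close> to every part and a new part \<open>1\<close> turns \<open>P\<close> into the shift by \<open>2\<close>
  of \<open>P\<close> with \<open>l\<close> zeros adjoined (\<open>positive_weights_lift\<close>). The number of ordered pairs inside \<open>P\<close>,
  which is the only quantity depending on the shape of the partition, therefore enters both sides in
  the same way and cancels. What is left is a polynomial identity in \<open>l\<close> and the size of \<open>P\<close>
  (\<open>gk_dim_identity\<close>).
\<close>

section \<open>Matrices over a field\<close>

lemma fring_simps [simp]:
  "carrier (fring :: 'k::field ring) = UNIV" "x \<otimes>\<^bsub>fring\<^esub> y = (x * y :: 'k::field)"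
  "\<one>\<^bsub>fring\<^esub> = (1 :: 'k)" "\<zero>\<^bsub>fring\<^esub> = (0 :: 'k)" "x \<oplus>\<^bsub>fring\<^esub> y = (x + y :: 'k)"
  by (simp_all add: ring_of_type_algebra_def)

lemma fring_uminus [simp]: "\<ominus>\<^bsub>fring\<^esub> x = (- x :: 'k::field)"
proof -
  interpret field "fring :: 'k ring" by (rule field_from_type_algebra)
  show ?thesis by (rule minus_equality) auto
qed

lemma fring_inv [simp]:
  assumes "x \<noteq> 0"
  shows "inv\<^bsub>fring\<^esub> x = (inverse x :: 'k::field)"
proof -
  interpret field "fring :: 'k ring" by (rule field_from_type_algebra)
  show ?thesis by (rule comm_inv_char) (use assms in auto)
qed

lemma fring_finsum [simp]: "finite A \<Longrightarrow> finsum fring f A = (\<Sum>x\<in>A. f x :: 'k::field)"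
proof (induction A rule: finite_induct)
  interpret field "fring :: 'k ring" by (rule field_from_type_algebra)
  case empty show ?case by simp
next
  interpret field "fring :: 'k ring" by (rule field_from_type_algebra)
  case (insert x F) then show ?case by (subst finsum_insert) auto
qed

lemma fring_finprod [simp]: "finite A \<Longrightarrow> finprod fring f A = (\<Prod>x\<in>A. f x :: 'k::field)"
proof (induction A rule: finite_induct)
  interpret field "fring :: 'k ring" by (rule field_from_type_algebra)
  case empty show ?case by simp
next
  interpret field "fring :: 'k ring" by (rule field_from_type_algebra)
  case (insert x F) then show ?case by (subst finprod_insert) auto
qed

lemma mone_fring: "mone n fring i j = (if i = j \<and> i \<in> {1..n} then 1 else (0::'k::field))"
  by (auto simp: mone_def mat_of_def)

lemma mmul_fring:
  "mmul n fring A B i j =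
     (if i \<in> {1..n} \<and> j \<in> {1..n} then \<Sum>l=1..n. A i l * B l j else (0::'k::field))"
  by (auto simp: mmul_def mat_of_def)

lemma antidiag_fring:
  "antidiag n fring i j =
     (if i \<in> {1..n} \<and> j \<in> {1..n} \<and> i + j = n + 1 then 1 else (0::'k::field))"
  by (auto simp: antidiag_def mat_of_def)

lemma mats_fring:
  "A \<in> mats n (fring :: 'k::field ring) \<longleftrightarrow> (\<forall>i j. \<not> (i \<in> {1..n} \<and> j \<in> {1..n}) \<longrightarrow> A i j = 0)"
  unfolding mats_def mat_of_def fun_eq_iff fring_simps mem_Collect_eq by (metis UNIV_I)

lemma mat_of_in_mats [simp]: "mat_of n fring f \<in> mats n (fring :: 'k::field ring)"
  by (auto simp: mats_fring mat_of_def)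

lemma mmul_in_mats [simp]: "mmul n fring A B \<in> mats n (fring :: 'k::field ring)"
  by (simp add: mmul_def)

lemma mone_in_mats [simp]: "mone n fring \<in> mats n (fring :: 'k::field ring)"
  by (simp add: mone_def)

lemma mmul_mone_left [simp]:
  "A \<in> mats n (fring :: 'k::field ring) \<Longrightarrow> mmul n fring (mone n fring) A = A"
  by (auto simp: fun_eq_iff mmul_fring mone_fring mats_fring if_distrib[of "\<lambda>x. x * _"] cong: if_cong
           intro!: sum.neutral split: if_splits)

lemma mmul_mone_right [simp]:
  "A \<in> mats n (fring :: 'k::field ring) \<Longrightarrow> mmul n fring A (mone n fring) = A"
  by (auto simp: fun_eq_iff mmul_fring mone_fring mats_fring if_distrib[of "\<lambda>x. _ * x"] cong: if_cong
           intro!: sum.neutral split: if_splits)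

lemma mmul_assoc:
  "mmul n fring (mmul n fring A B) C = mmul n fring A (mmul n (fring :: 'k::field ring) B C)"
proof (intro ext)
  fix i j
  have "(\<Sum>l=1..n. (\<Sum>m=1..n. A i m * B m l) * C l j) = (\<Sum>m=1..n. A i m * (\<Sum>l=1..n. B m l * C l j))"
    unfolding sum_distrib_left sum_distrib_right mult.assoc by (rule sum.swap)
  then show "mmul n fring (mmul n fring A B) C i j = mmul n fring A (mmul n fring B C) i j"
    by (auto simp: mmul_fring)
qed

lemma mtransp_mmul:
  "mtransp (mmul n fring A B) = mmul n (fring :: 'k::field ring) (mtransp B) (mtransp A)"
  by (auto simp: fun_eq_iff mmul_fring mtransp_def mult.commute)

section \<open>The orthogonal group and its root elements\<close>

text \<open>
  Membership in this set is a system of quadratic equations in the entries. Differentiating them bounds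
  the Lie algebras of subgroups from above.
\<close>

definition orth :: "nat \<Rightarrow> 'k::field sqmat set" where
  "orth n = {A \<in> mats n fring.
     mmul n fring (mmul n fring A (antidiag n fring)) (mtransp A) = antidiag n fring}"

lemma orth_iff:
  fixes A :: "'k::field sqmat"
  shows "A \<in> orth n \<longleftrightarrow> A \<in> mats n fring \<and> (\<forall>i\<in>{1..n}. \<forall>j\<in>{1..n}.
           (\<Sum>l=1..n. A i (n + 1 - l) * A j l) = (if i + j = n + 1 then 1 else 0))"
proof -
  have J: "(\<Sum>m=1..n. A i m * antidiag n fring m l) = A i (n + 1 - l)" if "l \<in> {1..n}" for i l
  proof -
    have "(\<Sum>m=1..n. A i m * antidiag n fring m l) = (\<Sum>m=1..n. if m = n + 1 - l then A i m else 0)"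
      by (rule sum.cong) (use that in \<open>auto simp: antidiag_fring\<close>)
    also have "\<dots> = A i (n + 1 - l)"
      using that by (auto simp: sum.delta)
    finally show ?thesis .
  qed
  have "mmul n fring (mmul n fring A (antidiag n fring)) (mtransp A) i j =
     (if i \<in> {1..n} \<and> j \<in> {1..n} then \<Sum>l=1..n. A i (n + 1 - l) * A j l else 0)" for i j
    unfolding mmul_fring mtransp_def by (auto intro!: sum.cong simp: J[simplified])
  then show ?thesis
    unfolding orth_def fun_eq_iff antidiag_fring by auto
qed

lemma orth_mmul:
  assumes "A \<in> orth n" "B \<in> orth n"
  shows "mmul n fring A B \<in> orth (n :: nat)"
proof -
  let ?m = "mmul n (fring :: 'a ring)" and ?J = "antidiag n (fring :: 'a ring)"
  have "?m (?m (?m A B) ?J) (mtransp (?m A B)) = ?m (?m A (?m (?m B ?J) (mtransp B))) (mtransp A)"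
    by (simp only: mtransp_mmul mmul_assoc)
  with assms show ?thesis by (simp add: orth_def)
qed

lemma mone_in_orth [simp]: "mone n fring \<in> (orth n :: 'k::field sqmat set)"
  unfolding orth_iff
proof (intro conjI ballI)
  fix i j assume ij: "i \<in> {1..n}" "j \<in> {1..n}"
  have "(\<Sum>l=1..n. mone n fring i (n + 1 - l) * mone n fring j l) =
        (\<Sum>l=1..n. if l = j then (if i + j = n + 1 then 1 else 0) else (0::'k))"
    by (rule sum.cong) (use ij in \<open>auto simp: mone_fring\<close>)
  also have "\<dots> = (if i + j = n + 1 then 1 else 0)"
    using ij by auto
  finally show "(\<Sum>l=1..n. mone n fring i (n + 1 - l) * mone n fring j l) =
        (if i + j = n + 1 then 1 else (0::'k))" .
qed simp

text \<open>
  A nontrivial permutation of \<open>{1..n}\<close> both raises and lowers some index, so only the identity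
  contributes to the Leibniz formula.
\<close>

lemma mdet_triangular:
  fixes A :: "'k::field sqmat"
  assumes "(\<forall>i\<in>{1..n}. \<forall>j\<in>{1..n}. j < i \<longrightarrow> A i j = 0) \<or> (\<forall>i\<in>{1..n}. \<forall>j\<in>{1..n}. i < j \<longrightarrow> A i j = 0)"
  shows "mdet n fring A = (\<Prod>i=1..n. A i i)"
proof -
  let ?f = "\<lambda>p. (if evenperm p then 1 else - 1) * (\<Prod>i=1..n. A i (p i))"
  have z: "(\<Prod>i=1..n. A i (p i)) = 0" if p: "p permutes {1..n}" "p \<noteq> id" for p
  proof -
    have "\<exists>i\<in>{1..n}. A i (p i) = 0"
      using assms
    proof
      assume *: "\<forall>i\<in>{1..n}. \<forall>j\<in>{1..n}. j < i \<longrightarrow> A i j = 0"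
      obtain i where "i \<in> {1..n}" "p i < i"
        using permutes_natset_ge[OF p(1)] p(2) not_le by blast
      with * permutes_in_image[OF p(1)] show ?thesis by blast
    next
      assume *: "\<forall>i\<in>{1..n}. \<forall>j\<in>{1..n}. i < j \<longrightarrow> A i j = 0"
      obtain i where "i \<in> {1..n}" "i < p i"
        using permutes_natset_le[OF p(1)] p(2) not_le by blast
      with * permutes_in_image[OF p(1)] show ?thesis by blast
    qed
    then show ?thesis by auto
  qed
  have fin: "finite {p. p permutes {1..n}}" by (rule finite_permutations) simp
  have "mdet n fring A = sum ?f {p. p permutes {1..n}}"
    unfolding mdet_def fring_finsum[OF fin] fring_finprod[OF finite_atLeastAtMost] by (simp cong: if_cong)
  also have "\<dots> = sum ?f {id}"
    by (rule sum.mono_neutral_right) (use fin z permutes_id in auto)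
  finally show ?thesis by (simp add: evenperm_id)
qed

lemma SO_fring: "SO n (fring :: 'k::field ring) = {A \<in> orth n. mdet n fring A = 1}"
  by (auto simp: SO_def SL_def orth_def)

lemma so_roots_distinct:
  assumes "(a, b) \<in> so_roots n"
  shows "a \<in> {1..n}" "b \<in> {1..n}" "n + 1 - a \<in> {1..n}" "n + 1 - b \<in> {1..n}"
    "a \<noteq> b" "a \<noteq> n + 1 - b" "b \<noteq> n + 1 - a" "n + 1 - a \<noteq> n + 1 - b"
    "\<not> (a = n + 1 - a \<and> b = n + 1 - b)"
  using assms by (auto simp: so_roots_def)

text \<open>
  The cascade of conditionals in the definition of a root element becomes a sum of elementary matrices,
  because the index pairs involved are pairwise distinct. The reflected indices get names of their own,
  so that later case distinctions only compare indices and never subtract them.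
\<close>

lemma so_root_elt_fring:
  fixes r :: "'k::field_char_0"
  assumes ab: "(a, b) \<in> so_roots n" and ij: "i \<in> {1..n}" "j \<in> {1..n}"
    and a': "n + 1 - a = a'" and b': "n + 1 - b = b'"
  shows "so_root_elt n fring a b r i j =
    (if j = i then 1 else 0) + (if i = a \<and> j = b then r else 0)
    - (if i = b' \<and> j = a' then r else 0)
    - (if (b = b' \<and> i = a) \<and> j = a' then r * r / 2 else 0)
    - (if (a = a' \<and> i = b') \<and> j = b then r * r / 2 else 0)"
proof -
  have h: "\<ominus>\<^bsub>fring\<^esub> (r \<otimes>\<^bsub>fring\<^esub> r \<otimes>\<^bsub>fring\<^esub> inv\<^bsub>fring\<^esub> (\<one>\<^bsub>fring\<^esub> \<oplus>\<^bsub>fring\<^esub> \<one>\<^bsub>fring\<^esub>)) = - (r * r / 2)"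
    by (simp add: field_simps)
  obtain q where q: "r * r / 2 = q" by blast
  show ?thesis
    using ij so_roots_distinct(5-)[OF ab] unfolding so_root_elt_def mat_of_def Let_def h a' b' q
    by (simp split del: if_split) (cases "i = a"; cases "i = b'"; cases "j = b"; cases "j = a'"; auto)
qed

text \<open>
  One row of a product with a root element. All matrix identities for root elements reduce to this sum
  of at most five terms.
\<close>

lemma so_root_elt_row_sum:
  fixes r :: "'k::field_char_0"
  assumes ab: "(a, b) \<in> so_roots n" and i: "i \<in> {1..n}"
    and a': "n + 1 - a = a'" and b': "n + 1 - b = b'"
  shows "(\<Sum>l=1..n. f l * so_root_elt n fring a b r i l) =
    f i + (if i = a then f b * r else 0)
    - (if i = b' then f a' * r else 0)
    - (if b = b' \<and> i = a then f a' * (r * r / 2) else 0)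
    - (if a = a' \<and> i = b' then f b * (r * r / 2) else 0)"
proof -
  have s: "(\<Sum>l=1..n. f l * (if P \<and> l = c then x else 0)) = (if P then f c * x else 0)"
    if "c \<in> {1..n}" for P c x
  proof -
    have "(\<Sum>l=1..n. f l * (if P \<and> l = c then x else 0)) = (\<Sum>l=1..n. if l = c then if P then f c * x else 0 else 0)"
      by (rule sum.cong) auto
    with that show ?thesis by simp
  qed
  have s': "(\<Sum>l=1..n. f l * (if l = c then x else 0)) = f c * x" if "c \<in> {1..n}" for c x
    using s[OF that, of True] by simp
  have "(\<Sum>l=1..n. f l * so_root_elt n fring a b r i l) = (\<Sum>l=1..n. f l * ((if l = i then 1 else 0)
    + (if i = a \<and> l = b then r else 0) - (if i = b' \<and> l = a' then r else 0)
    - (if (b = b' \<and> i = a) \<and> l = a' then r * r / 2 else 0)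
    - (if (a = a' \<and> i = b') \<and> l = b then r * r / 2 else 0)))"
    by (rule sum.cong[OF refl]) (simp only: so_root_elt_fring[OF ab i _ a' b'])
  also have "\<dots> = f i + (if i = a then f b * r else 0)
    - (if i = b' then f a' * r else 0)
    - (if b = b' \<and> i = a then f a' * (r * r / 2) else 0)
    - (if a = a' \<and> i = b' then f b * (r * r / 2) else 0)"
    using so_roots_distinct(1-4)[OF ab] i
    unfolding distrib_left right_diff_distrib sum.distrib sum_subtractf a' b' by (simp only: s s' mult_1_right)
  finally show ?thesis .
qed

lemma so_root_elt_in_mats [simp]: "so_root_elt n fring a b r \<in> mats n (fring :: 'k::field ring)"
  by (simp add: so_root_elt_def Let_def)

lemma so_root_elt_in_orth:
  fixes r :: "'k::field_char_0"
  assumes ab: "(a, b) \<in> so_roots n"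
  shows "so_root_elt n fring a b r \<in> orth n"
  unfolding orth_iff
proof (intro conjI ballI)
  let ?A = "so_root_elt n fring a b r"
  fix i j assume ij: "i \<in> {1..n}" "j \<in> {1..n}"
  obtain a' b' j' where a': "n + 1 - a = a'" and b': "n + 1 - b = b'" and j': "n + 1 - j = j'" by simp
  \<comment> \<open>Treating the coefficient of the square of the root vector as an atom avoids division.\<close>
  define q where "q = r * r / 2"
  have q: "r * r / 2 = q" "r * r = 2 * q" by (simp_all add: q_def)
  have inv: "n + 1 - a' = a" "n + 1 - b' = b"
    using so_roots_distinct(1,2)[OF ab] unfolding atLeastAtMost_iff a'[symmetric] b'[symmetric] by linarith+
  have eqs: "j = a \<longleftrightarrow> j' = a'" "j = b' \<longleftrightarrow> j' = b" "i + j = n + 1 \<longleftrightarrow> j' = i" "j' \<in> {1..n}"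
    using so_roots_distinct(1,2)[OF ab] ij
    unfolding atLeastAtMost_iff a'[symmetric] b'[symmetric] j'[symmetric] by linarith+
  note d = so_roots_distinct[OF ab, unfolded a' b']
  note A = so_root_elt_fring[OF ab ij(1) _ a' b', of _ r]
  show "(\<Sum>l=1..n. ?A i (n + 1 - l) * ?A j l) = (if i + j = n + 1 then 1 else 0)"
    unfolding so_root_elt_row_sum[OF ab ij(2) a' b'] inv a' b' j' eqs(1-3) A[OF d(1)] A[OF d(2)] A[OF d(3)] A[OF d(4)] A[OF eqs(4)]
    unfolding q(1)
    using d(5-)
    apply (cases "j' = a'"; cases "j' = b"; cases "i = a"; cases "i = b'"; cases "a = a'"; cases "b = b'")
    apply (simp_all only: not_sym simp_thms if_True if_False add_0 add_0_right diff_zero mult_zero_left mult_1 diff_0 mult_minus_left)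
    apply (simp_all split del: if_split add: q(2))
    done
qed simp

lemma so_root_elt_mmul_uminus:
  fixes r :: "'k::field_char_0"
  assumes ab: "(a, b) \<in> so_roots n"
  shows "mmul n fring (so_root_elt n fring a b r) (so_root_elt n fring a b (- r)) = mone n fring"
proof (intro ext)
  fix i j
  show "mmul n fring (so_root_elt n fring a b r) (so_root_elt n fring a b (- r)) i j = mone n fring i j"
  proof (cases "i \<in> {1..n} \<and> j \<in> {1..n}")
    case True
    then have ij: "i \<in> {1..n}" "j \<in> {1..n}" by auto
    obtain a' b' where a': "n + 1 - a = a'" and b': "n + 1 - b = b'" by simp
    define q where "q = r * r / 2"
    have q: "r * r / 2 = q" "r * r = 2 * q" by (simp_all add: q_def)
    note d = so_roots_distinct[OF ab, unfolded a' b']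
    note A = so_root_elt_fring[OF ab _ ij(2) a' b', of _ "- r"]
    have "mmul n fring (so_root_elt n fring a b r) (so_root_elt n fring a b (- r)) i j =
      (\<Sum>l=1..n. so_root_elt n fring a b (- r) l j * so_root_elt n fring a b r i l)"
      using ij by (simp add: mmul_fring mult.commute)
    also have "\<dots> = (if j = i then 1 else 0)"
      unfolding so_root_elt_row_sum[OF ab ij(1) a' b'] a' b' A[OF d(1)] A[OF d(2)] A[OF d(3)] A[OF d(4)] A[OF ij(1)]
      unfolding q(1) minus_mult_minus
      using d(5-)
      apply (cases "j = a'"; cases "j = b"; cases "i = a"; cases "i = b'"; cases "a = a'"; cases "b = b'")
      apply (simp_all only: not_sym simp_thms if_True if_False add_0 add_0_right diff_zero mult_zero_left mult_1 diff_0 mult_minus_left)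
      apply (simp_all only: minus_minus diff_minus_eq_add q(2) mult_2 minus_add_cancel diff_self left_minus)
      done
    also have "\<dots> = mone n fring i j" using ij by (simp add: mone_fring)
    finally show ?thesis .
  next
    case False
    then show ?thesis
      using mmul_in_mats mone_in_mats unfolding mats_fring by metis
  qed
qed

lemma so_root_elt_triangular:
  fixes r :: "'k::field_char_0"
  assumes ab: "(a, b) \<in> so_roots n" and ij: "i \<in> {1..n}" "j \<in> {1..n}"
  shows "so_root_elt n fring a b r i i = 1"
    and "a < b \<Longrightarrow> j < i \<Longrightarrow> so_root_elt n fring a b r i j = 0"
    and "b < a \<Longrightarrow> i < j \<Longrightarrow> so_root_elt n fring a b r i j = 0"
proof -
  note d = so_roots_distinct[OF ab]
  show "so_root_elt n fring a b r i i = 1"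
  proof -
    obtain a' b' where a': "n + 1 - a = a'" and b': "n + 1 - b = b'" by simp
    show ?thesis
      unfolding so_root_elt_fring[OF ab ij(1) ij(1) a' b'] using d(5-) unfolding a' b'
      by (cases "i = a"; cases "i = b'"; auto)
  qed
  have *: "so_root_elt n fring a b r i j = 0"
    if "\<not> (i = a \<and> j = b)" "\<not> (i = n + 1 - b \<and> j = n + 1 - a)"
      "\<not> ((b = n + 1 - b \<and> i = a) \<and> j = n + 1 - a)"
      "\<not> ((a = n + 1 - a \<and> i = n + 1 - b) \<and> j = b)" "j \<noteq> i"
    unfolding so_root_elt_fring[OF ab ij refl refl] by (simp only: that if_False) simp
  show "so_root_elt n fring a b r i j = 0" if "a < b" "j < i"
  proof (rule *)
    show "\<not> ((b = n + 1 - b \<and> i = a) \<and> j = n + 1 - a)" using d(1,2) that unfolding atLeastAtMost_iff by arith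
    show "\<not> ((a = n + 1 - a \<and> i = n + 1 - b) \<and> j = b)" using d(1,2) that unfolding atLeastAtMost_iff by arith
    show "\<not> (i = n + 1 - b \<and> j = n + 1 - a)" using d(1,2) that unfolding atLeastAtMost_iff by arith
  qed (use that in auto)
  show "so_root_elt n fring a b r i j = 0" if "b < a" "i < j"
  proof (rule *)
    show "\<not> ((b = n + 1 - b \<and> i = a) \<and> j = n + 1 - a)" using d(1,2) that unfolding atLeastAtMost_iff by arith
    show "\<not> ((a = n + 1 - a \<and> i = n + 1 - b) \<and> j = b)" using d(1,2) that unfolding atLeastAtMost_iff by arith
    show "\<not> (i = n + 1 - b \<and> j = n + 1 - a)" using d(1,2) that unfolding atLeastAtMost_iff by arith
  qed (use that in auto)
qed

lemma so_root_elt_in_SO: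
  fixes r :: "'k::field_char_0"
  assumes ab: "(a, b) \<in> so_roots n"
  shows "so_root_elt n fring a b r \<in> SO n fring"
proof -
  have "a < b \<or> b < a" using ab by (auto simp: so_roots_def)
  then have "mdet n fring (so_root_elt n fring a b r) = (\<Prod>i=1..n. so_root_elt n fring a b r i i)"
    by (intro mdet_triangular) (use so_root_elt_triangular(2,3)[OF ab] in blast)
  also have "\<dots> = 1"
    by (rule prod.neutral) (use so_root_elt_triangular(1)[OF ab] in blast)
  finally show ?thesis using so_root_elt_in_orth[OF ab] by (simp add: SO_fring)
qed

lemma SOg_simps [simp]:
  "carrier (SOg n R) = SO n R" "x \<otimes>\<^bsub>SOg n R\<^esub> y = mmul n R x y" "\<one>\<^bsub>SOg n R\<^esub> = mone n R"
  by (simp_all add: matgrp_def)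

text \<open>
  Unipotent groups are defined through \<open>generate\<close>, which closes under the abstract inverse of
  the matrix group. Identifying the inverse of a root element keeps inverses inside the root subgroup.
\<close>

lemma so_root_elt_inv:
  fixes r :: "'k::field_char_0"
  assumes ab: "(a, b) \<in> so_roots n"
  shows "inv\<^bsub>SOg n fring\<^esub> (so_root_elt n fring a b r) = so_root_elt n fring a b (- r)"
  unfolding m_inv_def
proof (rule the_equality)
  show "so_root_elt n fring a b (- r) \<in> carrier (SOg n fring) \<and>
    so_root_elt n fring a b r \<otimes>\<^bsub>SOg n fring\<^esub> so_root_elt n fring a b (- r) = \<one>\<^bsub>SOg n fring\<^esub> \<and>
    so_root_elt n fring a b (- r) \<otimes>\<^bsub>SOg n fring\<^esub> so_root_elt n fring a b r = \<one>\<^bsub>SOg n fring\<^esub>"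
    using so_root_elt_mmul_uminus[OF ab, of r] so_root_elt_mmul_uminus[OF ab, of "- r"]
      so_root_elt_in_SO[OF ab] by simp
next
  let ?x = "so_root_elt n fring a b r" and ?z = "so_root_elt n fring a b (- r)"
  fix y assume y: "y \<in> carrier (SOg n fring) \<and> ?x \<otimes>\<^bsub>SOg n fring\<^esub> y = \<one>\<^bsub>SOg n fring\<^esub> \<and>
    y \<otimes>\<^bsub>SOg n fring\<^esub> ?x = \<one>\<^bsub>SOg n fring\<^esub>"
  then have "y \<in> SO n fring" by simp
  then have "y \<in> mats n fring" by (simp add: SO_fring orth_def)
  then have "y = mmul n fring y (mmul n fring ?x ?z)"
    by (simp add: so_root_elt_mmul_uminus[OF ab])
  also have "\<dots> = mmul n fring (mmul n fring y ?x) ?z" by (simp add: mmul_assoc)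
  also have "\<dots> = ?z" using y by simp
  finally show "y = ?z" .
qed

section \<open>Tangent spaces and rational curves\<close>

text \<open>
  The matrix \<open>c\<close> is the gradient of \<open>p\<close> at the identity. It is characterized by its effect on rational
  curves \<open>Q(t) / d(t)\<close> through the identity: after clearing denominators by \<open>d(t)\<^sup>N\<close>, the first
  order coefficient of \<open>p\<close> along the curve is given by the chain rule. Denominators are needed for the
  diagonal torus, whose points \<open>(1 + t, 1 / (1 + t))\<close> are not polynomial in \<open>t\<close>.
\<close>

definition gradient_at_one :: "nat \<Rightarrow> ('k::field sqmat \<Rightarrow> 'k) \<Rightarrow> (nat \<Rightarrow> nat \<Rightarrow> 'k) \<Rightarrow> bool" where
  "gradient_at_one n p c \<longleftrightarrow> (\<forall>d Q. poly.coeff d 0 = 1 \<longrightarrow>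
     (\<forall>i j. poly.coeff (Q i j) 0 = mone n fring i j) \<longrightarrow>
     (\<exists>N R. (\<forall>t. poly d t \<noteq> 0 \<longrightarrow> p (\<lambda>i j. poly (Q i j) t / poly d t) * poly d t ^ N = poly R t) \<and>
        poly.coeff R 0 = p (mone n fring) \<and>
        poly.coeff R 1 = of_nat N * poly.coeff d 1 * p (mone n fring) +
          (\<Sum>i=1..n. \<Sum>j=1..n. c i j * (poly.coeff (Q i j) 1 - poly.coeff d 1 * mone n fring i j))))"

lemma coeff_0_power: "poly.coeff (d ^ N) 0 = poly.coeff d 0 ^ N"
  by (induction N) (simp_all add: coeff_mult_0)

lemma coeff_1_mult:
  "poly.coeff (p * q) 1 = poly.coeff p 0 * poly.coeff q 1 + poly.coeff p 1 * poly.coeff q 0"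
  by (simp add: coeff_mult)

lemma coeff_1_power:
  fixes d :: "'k::field poly"
  assumes "poly.coeff d 0 = 1"
  shows "poly.coeff (d ^ N) 1 = of_nat N * poly.coeff d 1"
proof (induction N)
  case (Suc N)
  then show ?case by (simp only: power_Suc coeff_1_mult coeff_0_power assms) (simp add: algebra_simps)
qed simp

lemma gradient_at_one_const: "gradient_at_one n (\<lambda>_. a) (\<lambda>_ _. 0)"
  unfolding gradient_at_one_def
  by (intro allI impI exI[of _ 0] exI[of _ "[:a:]"]) (auto simp: algebra_simps)

lemma gradient_at_one_coord:
  assumes "i \<in> {1..n}" "j \<in> {1..n}"
  shows "gradient_at_one n (\<lambda>A. A i j) (\<lambda>i' j'. if i' = i \<and> j' = j then 1 else (0 :: 'k::field))"
  unfolding gradient_at_one_def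
proof (intro allI impI)
  fix d :: "'k poly" and Q :: "nat \<Rightarrow> nat \<Rightarrow> 'k poly"
  assume *: "poly.coeff d 0 = 1" "\<forall>i j. poly.coeff (Q i j) 0 = mone n fring i j"
  have "(\<Sum>i'=1..n. \<Sum>j'=1..n. (if i' = i \<and> j' = j then 1 else 0) * f i' j') = f i j" for f :: "nat \<Rightarrow> nat \<Rightarrow> 'k"
  proof -
    have "(\<Sum>j'=1..n. (if i' = i \<and> j' = j then 1 else 0) * f i' j') = (if i' = i then f i j else 0)" for i'
      using assms by (cases "i' = i") (simp_all add: if_distrib[of "\<lambda>x. x * _"] cong: if_cong)
    with assms show ?thesis by simp
  qed
  with * show "\<exists>N R. (\<forall>t. poly d t \<noteq> 0 \<longrightarrow> poly (Q i j) t / poly d t * poly d t ^ N = poly R t) \<and>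
        poly.coeff R 0 = mone n fring i j \<and>
        poly.coeff R 1 = of_nat N * poly.coeff d 1 * mone n fring i j +
          (\<Sum>i'=1..n. \<Sum>j'=1..n. (if i' = i \<and> j' = j then 1 else 0) *
             (poly.coeff (Q i' j') 1 - poly.coeff d 1 * mone n fring i' j'))"
    by (intro exI[of _ 1] exI[of _ "Q i j"]) auto
qed

lemma gradient_at_one_add:
  assumes "gradient_at_one n p c" "gradient_at_one n q e"
  shows "gradient_at_one n (\<lambda>A. p A + q A) (\<lambda>i j. c i j + e i j :: 'k::field)"
  unfolding gradient_at_one_def
proof (intro allI impI)
  fix d :: "'k poly" and Q :: "nat \<Rightarrow> nat \<Rightarrow> 'k poly"
  assume *: "poly.coeff d 0 = 1" "\<forall>i j. poly.coeff (Q i j) 0 = mone n fring i j"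
  let ?D = "\<lambda>c. \<Sum>i=1..n. \<Sum>j=1..n. c i j * (poly.coeff (Q i j) 1 - poly.coeff d 1 * mone n fring i j)"
  let ?A = "\<lambda>t i j. poly (Q i j) t / poly d t"
  from assms(1) * obtain N R where R:
    "\<And>t. poly d t \<noteq> 0 \<Longrightarrow> p (?A t) * poly d t ^ N = poly R t"
    "poly.coeff R 0 = p (mone n fring)"
    "poly.coeff R 1 = of_nat N * poly.coeff d 1 * p (mone n fring) + ?D c"
    unfolding gradient_at_one_def by blast
  from assms(2) * obtain M T where T:
    "\<And>t. poly d t \<noteq> 0 \<Longrightarrow> q (?A t) * poly d t ^ M = poly T t"
    "poly.coeff T 0 = q (mone n fring)"
    "poly.coeff T 1 = of_nat M * poly.coeff d 1 * q (mone n fring) + ?D e"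
    unfolding gradient_at_one_def by blast
  show "\<exists>N R. (\<forall>t. poly d t \<noteq> 0 \<longrightarrow> (p (?A t) + q (?A t)) * poly d t ^ N = poly R t) \<and>
        poly.coeff R 0 = p (mone n fring) + q (mone n fring) \<and>
        poly.coeff R 1 = of_nat N * poly.coeff d 1 * (p (mone n fring) + q (mone n fring)) +
          ?D (\<lambda>i j. c i j + e i j)"
  proof (intro exI[of _ "N + M"] exI[of _ "R * d ^ M + T * d ^ N"] conjI allI impI)
    fix t assume "poly d t \<noteq> 0"
    then show "(p (?A t) + q (?A t)) * poly d t ^ (N + M) = poly (R * d ^ M + T * d ^ N) t"
      by (simp add: R(1)[symmetric] T(1)[symmetric] power_add algebra_simps)
  next
    have "?D (\<lambda>i j. c i j + e i j) = ?D c + ?D e"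
      by (simp add: distrib_right sum.distrib)
    then show "poly.coeff (R * d ^ M + T * d ^ N) 1 =
      of_nat (N + M) * poly.coeff d 1 * (p (mone n fring) + q (mone n fring)) + ?D (\<lambda>i j. c i j + e i j)"
      by (simp only: coeff_add coeff_1_mult coeff_0_power coeff_1_power[OF *(1)] R T * power_one
          of_nat_add) (simp add: algebra_simps)
  qed (simp add: coeff_mult_0 coeff_0_power R T *)
qed

lemma gradient_at_one_mult:
  assumes "gradient_at_one n p c" "gradient_at_one n q e"
  shows "gradient_at_one n (\<lambda>A. p A * q A)
    (\<lambda>i j. p (mone n fring) * e i j + q (mone n fring) * c i j :: 'k::field)"
  unfolding gradient_at_one_def
proof (intro allI impI)
  fix d :: "'k poly" and Q :: "nat \<Rightarrow> nat \<Rightarrow> 'k poly"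
  assume *: "poly.coeff d 0 = 1" "\<forall>i j. poly.coeff (Q i j) 0 = mone n fring i j"
  let ?D = "\<lambda>c. \<Sum>i=1..n. \<Sum>j=1..n. c i j * (poly.coeff (Q i j) 1 - poly.coeff d 1 * mone n fring i j)"
  let ?A = "\<lambda>t i j. poly (Q i j) t / poly d t"
  let ?g = "\<lambda>i j. p (mone n fring) * e i j + q (mone n fring) * c i j"
  from assms(1) * obtain N R where R:
    "\<And>t. poly d t \<noteq> 0 \<Longrightarrow> p (?A t) * poly d t ^ N = poly R t"
    "poly.coeff R 0 = p (mone n fring)"
    "poly.coeff R 1 = of_nat N * poly.coeff d 1 * p (mone n fring) + ?D c"
    unfolding gradient_at_one_def by blast
  from assms(2) * obtain M T where T:
    "\<And>t. poly d t \<noteq> 0 \<Longrightarrow> q (?A t) * poly d t ^ M = poly T t"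
    "poly.coeff T 0 = q (mone n fring)"
    "poly.coeff T 1 = of_nat M * poly.coeff d 1 * q (mone n fring) + ?D e"
    unfolding gradient_at_one_def by blast
  show "\<exists>N R. (\<forall>t. poly d t \<noteq> 0 \<longrightarrow> (p (?A t) * q (?A t)) * poly d t ^ N = poly R t) \<and>
        poly.coeff R 0 = p (mone n fring) * q (mone n fring) \<and>
        poly.coeff R 1 = of_nat N * poly.coeff d 1 * (p (mone n fring) * q (mone n fring)) + ?D ?g"
  proof (intro exI[of _ "N + M"] exI[of _ "R * T"] conjI allI impI)
    fix t assume "poly d t \<noteq> 0"
    then show "(p (?A t) * q (?A t)) * poly d t ^ (N + M) = poly (R * T) t"
      by (simp add: R(1)[symmetric] T(1)[symmetric] power_add)
  next
    have "?D ?g = p (mone n fring) * ?D e + q (mone n fring) * ?D c"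
      by (simp only: distrib_right sum.distrib sum_distrib_left mult.assoc)
    then show "poly.coeff (R * T) 1 =
      of_nat (N + M) * poly.coeff d 1 * (p (mone n fring) * q (mone n fring)) + ?D ?g"
      by (simp only: coeff_1_mult R T of_nat_add) (simp add: algebra_simps)
  qed (simp add: coeff_mult_0 R T)
qed

text \<open>
  The sum and product rules match the inductive definition of polynomial functions.
\<close>

lemma polyfuns_gradient: "p \<in> polyfuns n \<Longrightarrow> \<exists>c. gradient_at_one n p c"
proof (induction rule: polyfuns.induct)
  case (const a)
  show ?case by (rule exI) (rule gradient_at_one_const)
next
  case (coord i j)
  then show ?case by (intro exI) (rule gradient_at_one_coord)
next
  case (add p q)
  then obtain c e where "gradient_at_one n p c" "gradient_at_one n q e" by blast
  then show ?case by (intro exI) (rule gradient_at_one_add)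
next
  case (mult p q)
  then obtain c e where "gradient_at_one n p c" "gradient_at_one n q e" by blast
  then show ?case by (intro exI) (rule gradient_at_one_mult)
qed

lemma lie_algD:
  assumes "X \<in> lie_alg n S" "p \<in> polyfuns n" "\<And>A. A \<in> S \<Longrightarrow> p A = 0"
    and "\<And>t. p (\<lambda>i j. mone n fring i j + t * X i j) = poly q t"
  shows "poly.coeff q 1 = 0"
  using assms unfolding lie_alg_def by blast

text \<open>
  The field is infinite, so the polynomial describing \<open>p\<close> along a line through the identity is
  unique. The condition defining the Lie algebra is therefore linear in the direction.
\<close>

lemma lie_alg_condition_iff:
  fixes X :: "'k::field_char_0 sqmat"
  assumes p: "gradient_at_one n p c"
  shows "(\<forall>q. (\<forall>t. p (\<lambda>i j. mone n fring i j + t * X i j) = poly q t) \<longrightarrow> poly.coeff q 1 = 0) \<longleftrightarrow>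
    (\<Sum>i=1..n. \<Sum>j=1..n. c i j * X i j) = 0"
proof -
  let ?Q = "\<lambda>i j. [:mone n fring i j, X i j:]"
  have "\<forall>i j. poly.coeff (?Q i j) 0 = mone n fring i j" "poly.coeff (1 :: 'k poly) 0 = 1" by simp_all
  with p[unfolded gradient_at_one_def, THEN spec[of _ 1], THEN spec[of _ "?Q"]] obtain N R where
    "\<forall>t. poly 1 t \<noteq> 0 \<longrightarrow> p (\<lambda>i j. poly (?Q i j) t / poly 1 t) * poly 1 t ^ N = poly R t"
    "poly.coeff R 1 = of_nat N * poly.coeff 1 1 * p (mone n fring) +
          (\<Sum>i=1..n. \<Sum>j=1..n. c i j * (poly.coeff (?Q i j) 1 - poly.coeff 1 1 * mone n fring i j))"
    unfolding gradient_at_one_def by blast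
  then have R: "\<And>t. p (\<lambda>i j. mone n fring i j + t * X i j) = poly R t"
    and R1: "poly.coeff R 1 = (\<Sum>i=1..n. \<Sum>j=1..n. c i j * X i j)"
    by simp_all
  have "q = R" if "\<forall>t. p (\<lambda>i j. mone n fring i j + t * X i j) = poly q t" for q
  proof -
    have "poly q = poly R" using that R by (simp add: fun_eq_iff)
    then show ?thesis by (simp add: poly_eq_poly_eq_iff)
  qed
  with R R1 show ?thesis by metis
qed

text \<open>
  A function vanishing on \<open>S\<close> vanishes along a rational curve in \<open>S\<close>, except possibly at the
  finitely many zeros of the denominator. Its first order coefficient is then zero, and by the chain
  rule this is the pairing of its gradient with the velocity of the curve.
\<close>

lemma lie_algI_curve:
  fixes S :: "'k::field_char_0 sqmat set"
  assumes S: "\<And>t. poly d t \<noteq> 0 \<Longrightarrow> (\<lambda>i j. poly (Q i j) t / poly d t) \<in> S"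
    and d: "poly.coeff d 0 = 1" and Q: "\<And>i j. poly.coeff (Q i j) 0 = mone n fring i j"
    and X: "\<And>i j. X i j = poly.coeff (Q i j) 1 - poly.coeff d 1 * mone n fring i j"
      "X \<in> mats n fring"
  shows "X \<in> lie_alg n S"
  unfolding lie_alg_def
proof (intro CollectI conjI ballI impI)
  fix p assume p: "p \<in> polyfuns n" "\<forall>A\<in>S. p A = 0"
  obtain c where c: "gradient_at_one n p c" using polyfuns_gradient[OF p(1)] ..
  with d Q obtain N R where
    R: "\<And>t. poly d t \<noteq> 0 \<Longrightarrow> p (\<lambda>i j. poly (Q i j) t / poly d t) * poly d t ^ N = poly R t"
      "poly.coeff R 0 = p (mone n fring)"
      "poly.coeff R 1 = of_nat N * poly.coeff d 1 * p (mone n fring) +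
          (\<Sum>i=1..n. \<Sum>j=1..n. c i j * (poly.coeff (Q i j) 1 - poly.coeff d 1 * mone n fring i j))"
    unfolding gradient_at_one_def by blast
  have "poly (R * d) t = 0" for t
    using R(1)[of t] S[of t] p(2) by (cases "poly d t = 0") auto
  then have "R * d = 0"
    using poly_all_0_iff_0 by blast
  moreover have "d \<noteq> 0" using d by auto
  ultimately have "R = 0" by simp
  with R(2,3) have "(\<Sum>i=1..n. \<Sum>j=1..n. c i j * X i j) = 0" by (simp add: X(1))
  then show "\<forall>q. (\<forall>t. p (\<lambda>i j. mone n fring i j + t * X i j) = poly q t) \<longrightarrow> poly.coeff q 1 = 0"
    unfolding lie_alg_condition_iff[OF c] .
qed (fact X(2))

lemma vector_space_sqmat: "vector_space (\<lambda>(c::'k::field) (X::'k sqmat) i j. c * X i j)"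
  by unfold_locales (auto simp: fun_eq_iff algebra_simps)

lemma lie_alg_entry_zero:
  assumes X: "X \<in> lie_alg n S" and ij: "i \<in> {1..n}" "j \<in> {1..n}"
    and S: "\<And>A. A \<in> S \<Longrightarrow> A i j = mone n (fring :: 'k::field ring) i j"
  shows "X i j = 0"
proof -
  let ?p = "\<lambda>A. A i j + - mone n (fring :: 'k ring) i j"
  have "?p \<in> polyfuns n"
    by (intro polyfuns.add polyfuns.coord polyfuns.const ij)
  then have "poly.coeff [:0, X i j:] 1 = 0"
    by (rule lie_algD[OF X]) (simp_all add: S)
  then show ?thesis by simp
qed

lemma polyfuns_sum:
  assumes "\<And>x. x \<in> F \<Longrightarrow> f x \<in> polyfuns n"
  shows "(\<lambda>A. \<Sum>x\<in>F. f x A) \<in> polyfuns n"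
  using assms
proof (induction F rule: infinite_finite_induct)
  case (insert x F)
  then show ?case using polyfuns.add[of "f x" n "\<lambda>A. \<Sum>x\<in>F. f x A"] by simp
qed (auto intro: polyfuns.const)

text \<open>
  Differentiating \<open>A J A\<^sup>T = J\<close> at the identity gives \<open>X J + J X\<^sup>T = 0\<close>, that is,
  skew symmetry under reflection in the antidiagonal.
\<close>

lemma lie_alg_orth_skew:
  fixes X :: "'k::field sqmat"
  assumes X: "X \<in> lie_alg n S" and ij: "i \<in> {1..n}" "j \<in> {1..n}" and S: "S \<subseteq> orth n"
  shows "X i j = - X (n + 1 - j) (n + 1 - i)"
proof -
  define j' where "j' = n + 1 - j"
  have j': "j' \<in> {1..n}" "n + 1 - j' = j" using ij by (auto simp: j'_def)
  define i' where "i' = n + 1 - i"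
  have i': "i' \<in> {1..n}" "i' + i = n + 1" using ij by (auto simp: i'_def)
  let ?\<delta> = "if i + j' = n + 1 then 1 else (0 :: 'k)"
  let ?p = "\<lambda>A. (\<Sum>l=1..n. A i (n + 1 - l) * A j' l) + - ?\<delta>"
  have p: "?p \<in> polyfuns n"
    by (intro polyfuns.add polyfuns_sum polyfuns.mult polyfuns.coord polyfuns.const) (use ij j' in auto)
  have z: "\<forall>A\<in>S. ?p A = 0"
  proof
    fix A assume "A \<in> S"
    then have "A \<in> orth n" using S by blast
    then have "(\<Sum>l=1..n. A i (n + 1 - l) * A j' l) = ?\<delta>"
      using ij(1) j'(1) unfolding orth_iff by blast
    then show "?p A = 0" by (simp only: add.right_inverse)
  qed
  \<comment> \<open>Only the linear coefficient matters; it comes from the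
    products of an entry of the identity with an entry of \<open>t X\<close>.\<close>
  let ?q = "[:0, X i j + X j' i', \<Sum>l=1..n. X i (n + 1 - l) * X j' l:]"
  have "\<forall>t. ?p (\<lambda>i j. mone n fring i j + t * X i j) = poly ?q t"
  proof
    fix t
    have m: "(mone n fring i (n + 1 - l) + t * X i (n + 1 - l)) * (mone n fring j' l + t * X j' l) =
      (if l = j' then ?\<delta> + t * X i j else 0) + (if l = i' then t * X j' i' else 0)
         + t * t * (X i (n + 1 - l) * X j' l)" if l: "l \<in> {1..n}" for l
    proof -
      have "mone n fring i (n + 1 - l) = (if l = i' then 1 else (0 :: 'k))"
        "mone n fring j' l = (if l = j' then 1 else (0 :: 'k))"
        unfolding mone_fring using ij(1) j'(1) i' l unfolding atLeastAtMost_iff by (intro if_cong refl; arith)+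
      moreover have "i + j' = n + 1 \<longleftrightarrow> j' = i'" using i'(2) by arith
      moreover have "l = j' \<Longrightarrow> X i (n + 1 - l) = X i j" using j'(2) by simp
      ultimately show ?thesis
        by (cases "l = i'"; cases "l = j'"; simp only: if_True if_False; simp add: distrib_left distrib_right)
    qed
    have "(\<Sum>l=1..n. (mone n fring i (n + 1 - l) + t * X i (n + 1 - l)) * (mone n fring j' l + t * X j' l)) =
      (\<Sum>l=1..n. (if l = j' then ?\<delta> + t * X i j else 0) + (if l = i' then t * X j' i' else 0)
         + t * t * (X i (n + 1 - l) * X j' l))"
      by (rule sum.cong[OF refl m])
    also have "\<dots> = ?\<delta> + t * X i j + t * X j' i' + t * t * (\<Sum>l=1..n. X i (n + 1 - l) * X j' l)"
      unfolding sum.distrib sum_distrib_left using j'(1) i'(1) by simp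
    finally show "?p (\<lambda>i j. mone n fring i j + t * X i j) = poly ?q t"
      by (simp add: algebra_simps)
  qed
  then have "poly.coeff ?q 1 = 0"
    by (intro lie_algD[OF X p]) (use z in blast)+
  then show ?thesis unfolding j'_def i'_def by (simp add: eq_neg_iff_add_eq_0)
qed

section \<open>Skew matrices with prescribed support\<close>

text \<open>
  The Lie algebras below consist of the matrices that are skew under reflection in the antidiagonal and
  supported on the positions in \<open>Q\<close>. In characteristic zero the antidiagonal
  entries vanish by skewness, so \<open>Q\<close> does not
  constrain them.
\<close>

definition skew :: "nat \<Rightarrow> (nat \<Rightarrow> nat \<Rightarrow> bool) \<Rightarrow> 'k::field sqmat set" where
  "skew n Q = {X \<in> mats n fring.
     (\<forall>a\<in>{1..n}. \<forall>b\<in>{1..n}. X a b = - X (n + 1 - b) (n + 1 - a)) \<and>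
     (\<forall>a\<in>{1..n}. \<forall>b\<in>{1..n}. a + b \<noteq> n + 1 \<and> \<not> Q a b \<longrightarrow> X a b = 0)}"

text \<open>
  Reflection in the antidiagonal exchanges the positions above it with those below it, so the
  positions above it represent the orbits of the reflection on the remaining ones.
\<close>

definition above_antidiag :: "nat \<Rightarrow> (nat \<Rightarrow> nat \<Rightarrow> bool) \<Rightarrow> (nat \<times> nat) set" where
  "above_antidiag n Q = {(a, b). a \<in> {1..n} \<and> b \<in> {1..n} \<and> a + b \<le> n \<and> Q a b}"

definition skew_unit :: "nat \<Rightarrow> nat \<Rightarrow> nat \<Rightarrow> 'k::field sqmat" where
  "skew_unit n a b = (\<lambda>i j. (if i = a \<and> j = b then 1 else 0) - (if i = n + 1 - b \<and> j = n + 1 - a then 1 else 0))"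

lemma finite_above_antidiag [simp]: "finite (above_antidiag n Q)"
  by (rule finite_subset[of _ "{1..n} \<times> {1..n}"]) (auto simp: above_antidiag_def)

lemma skew_unit_apply:
  assumes "(a, b) \<in> above_antidiag n Q" "(i, j) \<in> above_antidiag n Q'"
  shows "skew_unit n a b i j = (if (i, j) = (a, b) then 1 else 0)"
proof -
  have "\<not> (i = n + 1 - b \<and> j = n + 1 - a)"
    using assms unfolding above_antidiag_def by auto
  then show ?thesis by (simp add: skew_unit_def)
qed

lemma sum_sqmat_apply:
  "(\<Sum>x\<in>F. f x) i j = (\<Sum>x\<in>F. (f x :: 'k::field sqmat) i j)"
  by (induction F rule: infinite_finite_induct) auto

lemma skew_decompose:
  fixes X :: "'k::field_char_0 sqmat"
  assumes X: "X \<in> skew n Q"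
    and sym: "\<And>a b. a \<in> {1..n} \<Longrightarrow> b \<in> {1..n} \<Longrightarrow> Q a b \<Longrightarrow> Q (n + 1 - b) (n + 1 - a)"
  shows "X = (\<Sum>(a, b)\<in>above_antidiag n Q. (\<lambda>i j. X a b * skew_unit n a b i j))"
proof (intro ext)
  fix i j
  let ?H = "above_antidiag n Q"
  have skewX: "X i j = - X (n + 1 - j) (n + 1 - i)" if "i \<in> {1..n}" "j \<in> {1..n}" for i j
    using X that unfolding skew_def by blast
  have zeroX: "X i j = 0" if "i \<in> {1..n}" "j \<in> {1..n}" "i + j \<noteq> n + 1" "\<not> Q i j" for i j
    using X that unfolding skew_def by blast
  have "(\<Sum>(a, b)\<in>?H. (\<lambda>i j. X a b * skew_unit n a b i j)) i j =
    (\<Sum>x\<in>?H. (if x = (i, j) then X i j else 0) - (if i \<in> {1..n} \<and> j \<in> {1..n} \<and> x = (n + 1 - j, n + 1 - i) then X (n + 1 - j) (n + 1 - i) else 0))"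
    unfolding sum_sqmat_apply
  proof (rule sum.cong[OF refl], clarify)
    fix a b assume ab: "(a, b) \<in> ?H"
    then have "a \<in> {1..n}" "b \<in> {1..n}" unfolding above_antidiag_def by auto
    let ?C = "i \<in> {1..n} \<and> j \<in> {1..n} \<and> (a, b) = (n + 1 - j, n + 1 - i)"
    from \<open>a \<in> {1..n}\<close> \<open>b \<in> {1..n}\<close> have C: "i = n + 1 - b \<and> j = n + 1 - a \<longleftrightarrow> ?C"
      unfolding atLeastAtMost_iff prod.inject by (intro iffI conjI; elim conjE; linarith)
    have "X a b * skew_unit n a b i j =
      X a b * (if i = a \<and> j = b then 1 else 0) - X a b * (if ?C then 1 else 0)"
      unfolding skew_unit_def C right_diff_distrib ..
    moreover have "X a b * (if i = a \<and> j = b then 1 else 0) = (if (a, b) = (i, j) then X i j else 0)"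
      by auto
    moreover have "X a b * (if ?C then 1 else 0) = (if ?C then X (n + 1 - j) (n + 1 - i) else 0)"
    proof (cases ?C)
      case True
      then have "a = n + 1 - j" "b = n + 1 - i" by blast+
      then have "X a b = X (n + 1 - j) (n + 1 - i)" by (simp only:)
      then show ?thesis unfolding if_P[OF True] by (simp only: mult_1_right)
    qed (simp only: if_False mult_zero_right)
    ultimately show "X a b * skew_unit n a b i j = (if (a, b) = (i, j) then X i j else 0)
        - (if ?C then X (n + 1 - j) (n + 1 - i) else 0)"
      by (simp only:)
  qed
  also have "\<dots> = (if (i, j) \<in> ?H then X i j else 0) -
     (if i \<in> {1..n} \<and> j \<in> {1..n} \<and> (n + 1 - j, n + 1 - i) \<in> ?H then X (n + 1 - j) (n + 1 - i) else 0)"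
  proof -
    have *: "(\<Sum>x\<in>?H. if A \<and> B \<and> x = z then c else 0) = (if A \<and> B \<and> z \<in> ?H then c else 0)"
      for A B z and c :: 'k
      by (cases A; cases B) simp_all
    show ?thesis unfolding sum_subtractf * by simp
  qed
  also have "\<dots> = X i j"
  proof (cases "i \<in> {1..n} \<and> j \<in> {1..n}")
    case False
    then have "X i j = 0" using X unfolding skew_def mats_fring by blast
    moreover have "\<not> (i \<in> {1..n} \<and> j \<in> {1..n} \<and> P)" for P using False by blast
    ultimately show ?thesis by (simp only: if_False if_cancel diff_self)
  next
    case True
    then have ij: "i \<in> {1..n}" "j \<in> {1..n}" by auto
    define i' j' where "i' = n + 1 - i" and "j' = n + 1 - j"
    have ij': "i' \<in> {1..n}" "j' \<in> {1..n}" "n + 1 - i' = i" "n + 1 - j' = j" "i + i' = n + 1" "j + j' = n + 1"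
      using ij unfolding i'_def j'_def atLeastAtMost_iff by (linarith | (intro conjI; linarith))+
    have H: "(i, j) \<in> ?H \<longleftrightarrow> i + j \<le> n \<and> Q i j" "(j', i') \<in> ?H \<longleftrightarrow> i' + j' \<le> n \<and> Q j' i'"
      using ij ij'(1,2) unfolding above_antidiag_def by auto
    have Q: "Q i j \<longleftrightarrow> Q j' i'"
      using sym[OF ij] sym[OF ij'(2,1)] unfolding ij'(3,4) i'_def[symmetric] j'_def[symmetric] by blast
    have skew: "X i j = - X j' i'" using skewX[OF ij] by (simp only: i'_def j'_def)
    consider "i + j \<le> n" | "i + j = n + 1" | "i + j \<ge> n + 2" by linarith
    then have "(if (i, j) \<in> ?H then X i j else 0) - (if (j', i') \<in> ?H then X j' i' else 0) = X i j"
    proof cases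
      case 1
      then have "\<not> i' + j' \<le> n" using ij'(5,6) by linarith
      with 1 zeroX[OF ij] show ?thesis unfolding H by auto
    next
      case 2
      then have "j' = i" "i' = j" using ij'(5,6) by linarith+
      with skew have "X i j = - X i j" by simp
      then have "X i j = 0" by simp
      with \<open>j' = i\<close> \<open>i' = j\<close> show ?thesis by simp
    next
      case 3
      then have "i' + j' \<le> n" using ij'(5,6) by linarith
      with 3 zeroX[OF ij] show ?thesis unfolding H Q skew by auto
    qed
    with ij show ?thesis by (simp only: i'_def j'_def simp_thms if_True)
  qed
  finally show "X i j = (\<Sum>(a, b)\<in>?H. (\<lambda>i j. X a b * skew_unit n a b i j)) i j" ..
qed

text \<open>
  The units \<open>skew_unit n a b\<close> over the positions above the antidiagonal form a basis of \<open>skew n Q\<close>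
  when \<open>Q\<close> is invariant under reflection,
  so a Lie algebra that contains these units and lies in \<open>skew n Q\<close> has their number as its
  dimension.
\<close>

lemma alg_dim_eq_card:
  fixes S :: "'k::field_char_0 sqmat set"
  assumes upper: "lie_alg n S \<subseteq> skew n Q"
    and lower: "\<And>a b. (a, b) \<in> above_antidiag n Q \<Longrightarrow> skew_unit n a b \<in> lie_alg n S"
    and sym: "\<And>a b. a \<in> {1..n} \<Longrightarrow> b \<in> {1..n} \<Longrightarrow> Q a b \<Longrightarrow> Q (n + 1 - b) (n + 1 - a)"
  shows "alg_dim n S = card (above_antidiag n Q)"
proof -
  interpret vector_space "\<lambda>(c::'k) (X::'k sqmat) i j. c * X i j" by (rule vector_space_sqmat)
  let ?H = "above_antidiag n Q" and ?E = "\<lambda>(a, b). skew_unit n a b :: 'k sqmat"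
  have inj: "inj_on ?E ?H"
  proof (rule inj_onI, clarify)
    fix a b c d assume *: "(a, b) \<in> ?H" "(c, d) \<in> ?H" "skew_unit n a b = (skew_unit n c d :: 'k sqmat)"
    have "skew_unit n a b a b = (skew_unit n c d a b :: 'k)" using *(3) by simp
    then show "a = c \<and> b = d"
      unfolding skew_unit_apply[OF *(1,1)] skew_unit_apply[OF *(2,1)] by (auto split: if_splits)
  qed
  show ?thesis
    unfolding alg_dim_def
  proof (rule dim_unique)
    show "?E ` ?H \<subseteq> lie_alg n S" using lower by auto
    show "lie_alg n S \<subseteq> span (?E ` ?H)"
    proof
      fix X assume "X \<in> lie_alg n S"
      then have X: "X \<in> skew n Q" using upper by blast
      have "(\<Sum>(a, b)\<in>?H. (\<lambda>i j. X a b * skew_unit n a b i j)) \<in> span (?E ` ?H)"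
        by (rule span_sum, clarify, rule span_scale, rule span_base) force
      also have "(\<Sum>(a, b)\<in>?H. (\<lambda>i j. X a b * skew_unit n a b i j)) = X"
        by (rule skew_decompose[OF X sym, symmetric])
      finally show "X \<in> span (?E ` ?H)" .
    qed
    show "independent (?E ` ?H)"
    proof (rule independent_if_scalars_zero)
      fix f Y assume *: "(\<Sum>Y\<in>?E ` ?H. (\<lambda>i j. f Y * Y i j)) = 0" "Y \<in> ?E ` ?H"
      then obtain a b where ab: "(a, b) \<in> ?H" "Y = skew_unit n a b" by auto
      have "0 = (\<Sum>Y\<in>?E ` ?H. (\<lambda>i j. f Y * Y i j)) a b" using *(1) by simp
      also have "\<dots> = (\<Sum>x\<in>?H. f (?E x) * ?E x a b)"
        unfolding sum_sqmat_apply by (subst sum.reindex[OF inj]) simp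
      also have "\<dots> = (\<Sum>x\<in>?H. if x = (a, b) then f Y else 0)"
      proof (rule sum.cong[OF refl])
        fix x assume x: "x \<in> ?H"
        then have "(fst x, snd x) \<in> ?H" by simp
        from skew_unit_apply[OF this ab(1)] have "?E x a b = (if x = (a, b) then 1 else 0)"
          by (auto simp: case_prod_beta prod_eq_iff)
        then show "f (?E x) * ?E x a b = (if x = (a, b) then f Y else 0)"
          using ab(2) by (cases "x = (a, b)") simp_all
      qed
      finally show "f Y = 0" using ab(1) by simp
    qed simp
    show "card (?E ` ?H) = card ?H" by (rule card_image[OF inj])
  qed
qed

section \<open>Dimensions of the orthogonal group and of its unipotent subgroups\<close>

text \<open>
  The velocity of a root subgroup at the identity is its root vector.
\<close>

lemma skew_unit_in_lie_alg:
  fixes S :: "'k::field_char_0 sqmat set"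
  assumes ab: "(a, b) \<in> so_roots n" and S: "\<And>t. so_root_elt n fring a b t \<in> S"
  shows "skew_unit n a b \<in> lie_alg n S"
proof -
  obtain a' b' where a': "n + 1 - a = a'" and b': "n + 1 - b = b'" by blast
  \<comment> \<open>The curve is quadratic: \<open>c\<close> is minus the coefficient of \<open>t\<^sup>2\<close>, nonzero
    only for short roots.\<close>
  define c where "c i j = (if (b = b' \<and> i = a) \<and> j = a' then 1 / 2 else 0)
    + (if (a = a' \<and> i = b') \<and> j = b then 1 / 2 else (0 :: 'k))" for i j
  define Q where "Q i j = (if i \<in> {1..n} \<and> j \<in> {1..n}
     then [:if j = i then 1 else 0, skew_unit n a b i j, - c i j:] else 0)" for i j
  have Qt: "poly (Q i j) t = so_root_elt n fring a b t i j" for i j t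
  proof (cases "i \<in> {1..n} \<and> j \<in> {1..n}")
    case True
    then have ij: "i \<in> {1..n}" "j \<in> {1..n}" by auto
    have "poly (Q i j) t = (if j = i then 1 else 0) + t * skew_unit n a b i j - t * t * c i j"
      unfolding Q_def if_P[OF True] by (simp add: algebra_simps)
    also have "\<dots> = so_root_elt n fring a b t i j"
      unfolding so_root_elt_fring[OF ab ij a' b'] skew_unit_def c_def a' b'
        distrib_left right_diff_distrib if_distrib[of "\<lambda>x. t * x"] if_distrib[of "\<lambda>x. t * t * x"]
      by (simp cong: if_cong)
    finally show ?thesis .
  next
    case False
    then show ?thesis
      using so_root_elt_in_mats[of n a b t] unfolding mats_fring Q_def if_not_P[OF False] by simp
  qed
  have u: "skew_unit n a b \<in> (mats n fring :: 'k sqmat set)"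
    using so_roots_distinct(1-4)[OF ab] unfolding mats_fring skew_unit_def by auto
  show ?thesis
  proof (rule lie_algI_curve[where d = 1 and Q = Q])
    show "(\<lambda>i j. poly (Q i j) t / poly 1 t) \<in> S" for t
      using S[of t] by (simp add: Qt)
    show "poly.coeff (Q i j) 0 = mone n fring i j" for i j
      unfolding Q_def mone_fring by auto
    show "skew_unit n a b i j = poly.coeff (Q i j) 1 - poly.coeff 1 1 * mone n fring i j" for i j
      using u unfolding Q_def mats_fring by auto
  qed (use u in simp_all)
qed

lemma torus_in_SO:
  fixes x :: "'k::field_char_0"
  assumes a: "a \<in> {1..n}" "2 * a \<le> n" and x: "x \<noteq> 0"
  shows "(\<lambda>i j. if i = j \<and> i \<in> {1..n} then if i = a then x else if i = n + 1 - a then 1 / x else 1 else 0)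
    \<in> SO n fring" (is "?A \<in> _")
proof -
  define D where "D i = (if i = a then x else if i = n + 1 - a then 1 / x else 1)" for i
  have A: "?A = (\<lambda>i j. if i = j \<and> i \<in> {1..n} then D i else 0)" unfolding D_def ..
  have DD: "D i * D (n + 1 - i) = 1" if "i \<in> {1..n}" for i
  proof -
    have "n + 1 - i = a \<longleftrightarrow> i = n + 1 - a" "n + 1 - i = n + 1 - a \<longleftrightarrow> i = a" "a \<noteq> n + 1 - a"
      using that a unfolding atLeastAtMost_iff by arith+
    then show ?thesis unfolding D_def using x by auto
  qed
  have "?A \<in> orth n"
    unfolding A orth_iff
  proof (intro conjI ballI)
    show "(\<lambda>i j. if i = j \<and> i \<in> {1..n} then D i else 0) \<in> mats n fring"
      unfolding mats_fring by auto
    fix i j assume ij: "i \<in> {1..n}" "j \<in> {1..n}"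
    let ?B = "\<lambda>i j. if i = j \<and> i \<in> {1..n} then D i else 0"
    have "(\<Sum>l=1..n. ?B i (n + 1 - l) * ?B j l) = (\<Sum>l=1..n. if l = j then ?B i (n + 1 - l) * D l else 0)"
      by (rule sum.cong) auto
    also have "\<dots> = ?B i (n + 1 - j) * D j" using ij by simp
    also have "\<dots> = (if i + j = n + 1 then 1 else 0)"
    proof -
      have "i = n + 1 - j \<longleftrightarrow> i + j = n + 1" using ij unfolding atLeastAtMost_iff by arith
      moreover have "j = n + 1 - i" if "i + j = n + 1" using that by arith
      ultimately show ?thesis using DD[OF ij(1)] ij(1) by (cases "i + j = n + 1") simp_all
    qed
    finally show "(\<Sum>l=1..n. ?B i (n + 1 - l) * ?B j l) = (if i + j = n + 1 then 1 else 0)" .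
  qed
  moreover have "mdet n fring ?A = 1"
  proof -
    have "mdet n fring ?A = (\<Prod>i=1..n. D i)"
      unfolding A by (subst mdet_triangular) (auto intro!: prod.cong)
    also have "\<dots> = (\<Prod>i\<in>{a, n + 1 - a}. D i)"
      by (rule prod.mono_neutral_right) (use a in \<open>auto simp: D_def\<close>)
    also have "\<dots> = 1"
    proof -
      have "a \<noteq> n + 1 - a" using a by simp
      then show ?thesis using DD[OF a(1)] by simp
    qed
    finally show ?thesis .
  qed
  ultimately show ?thesis by (simp add: SO_fring)
qed

text \<open>
  Diagonal units are velocities of the curve with entries \<open>1 + t\<close> and \<open>1 / (1 + t)\<close> in
  reflected positions.
\<close>

lemma torus_unit_in_lie_alg:
  assumes a: "a \<in> {1..n}" "2 * a \<le> n"
  shows "skew_unit n a a \<in> lie_alg n (SO n (fring :: 'k::field_char_0 ring))"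
proof -
  define d :: "'k poly" where "d = [:1, 1:]"
  obtain a' where a': "n + 1 - a = a'" by blast
  have aa: "a' \<in> {1..n}" "a \<noteq> a'" using a unfolding atLeastAtMost_iff a'[symmetric] by linarith+
  define Q where "Q i j = (if i = j \<and> i \<in> {1..n} then
    if i = a then [:1, 2, 1:] else if i = a' then 1 else d else 0)" for i j
  show ?thesis
  proof (rule lie_algI_curve[where d = d and Q = Q])
    fix t assume t: "poly d t \<noteq> 0"
    have "poly [:1, 2, 1:] t = poly d t * poly d t" by (simp add: d_def algebra_simps)
    with t have "(\<lambda>i j. poly (Q i j) t / poly d t) = (\<lambda>i j. if i = j \<and> i \<in> {1..n} then
        if i = a then poly d t else if i = a' then 1 / poly d t else 1 else 0)"
      unfolding Q_def by (intro ext) (simp only: if_distrib[of "\<lambda>p. poly p t / poly d t"] poly_0 poly_1 div_0 divide_self nonzero_mult_div_cancel_left not_False_eq_True cong: if_cong)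
    with torus_in_SO[OF a t, unfolded a'] show "(\<lambda>i j. poly (Q i j) t / poly d t) \<in> SO n fring" by simp
  next
    show "poly.coeff (Q i j) 0 = mone n fring i j" for i j
      unfolding Q_def mone_fring d_def by simp
    show "skew_unit n a a i j = poly.coeff (Q i j) 1 - poly.coeff d 1 * mone n fring i j" for i j
      using a(1) aa unfolding skew_unit_def Q_def mone_fring d_def a'
      by (cases "i = j"; cases "i = a"; cases "i = a'"; auto)
    show "skew_unit n a a \<in> mats n fring"
      using a(1) aa unfolding mats_fring skew_unit_def a' by auto
  qed (simp add: d_def)
qed

lemma alg_dim_SO:
  "alg_dim n (SO n (fring :: 'k::field_char_0 ring)) = card (above_antidiag n (\<lambda>_ _. True))"
proof (rule alg_dim_eq_card)
  let ?S = "SO n (fring :: 'k ring)"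
  show "lie_alg n ?S \<subseteq> skew n (\<lambda>_ _. True)"
  proof
    fix X assume X: "X \<in> lie_alg n ?S"
    have "?S \<subseteq> orth n" by (auto simp: SO_fring)
    then have "\<forall>a\<in>{1..n}. \<forall>b\<in>{1..n}. X a b = - X (n + 1 - b) (n + 1 - a)"
      using lie_alg_orth_skew[OF X] by blast
    moreover have "X \<in> mats n fring" using X by (simp add: lie_alg_def)
    ultimately show "X \<in> skew n (\<lambda>_ _. True)" by (simp add: skew_def)
  qed
  fix a b assume ab: "(a, b) \<in> above_antidiag n (\<lambda>_ _. True)"
  show "skew_unit n a b \<in> lie_alg n ?S"
  proof (cases "a = b")
    case True
    with ab have "a \<in> {1..n}" "2 * a \<le> n" by (auto simp: above_antidiag_def)
    with torus_unit_in_lie_alg True show ?thesis by blast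
  next
    case False
    with ab have "(a, b) \<in> so_roots n" by (auto simp: above_antidiag_def so_roots_def)
    then show ?thesis by (intro skew_unit_in_lie_alg so_root_elt_in_SO)
  qed
qed

text \<open>
  If the positions in \<open>P\<close> are closed under composition, the matrices that agree with the identity off
  \<open>P\<close> are closed under multiplication. They contain the generating root subgroups, hence the whole
  group, which bounds the Lie algebra from above. The root subgroups bound it from below.
\<close>

lemma alg_dim_root_generated:
  assumes pos: "\<And>a b. P a b \<Longrightarrow> a < b"
    and trans: "\<And>a b c. P a b \<Longrightarrow> P b c \<Longrightarrow> P a c"
    and sym: "\<And>a b. a \<in> {1..n} \<Longrightarrow> b \<in> {1..n} \<Longrightarrow> P a b \<Longrightarrow> P (n + 1 - b) (n + 1 - a)"
  shows "alg_dim n (root_generated n (fring :: 'k::field_char_0 ring) P) = card (above_antidiag n P)"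
proof (rule alg_dim_eq_card)
  let ?S = "root_generated n (fring :: 'k ring) P"
  define U where "U = {A \<in> orth n. \<forall>i\<in>{1..n}. \<forall>j\<in>{1..n}. \<not> P i j \<longrightarrow> A i j = (mone n fring i j :: 'k)}"
  have root: "so_root_elt n fring a b r \<in> U" if ab: "(a, b) \<in> so_roots n" "P a b" for a b r
    unfolding U_def mem_Collect_eq
  proof (intro conjI ballI impI)
    fix i j assume ij: "i \<in> {1..n}" "j \<in> {1..n}" and n: "\<not> P i j"
    obtain a' b' where a': "n + 1 - a = a'" and b': "n + 1 - b = b'" by blast
    note d = so_roots_distinct[OF ab(1), unfolded a' b']
    \<comment> \<open>The quadratic entries of a short root element lie at positions
      composed of \<open>(a, b)\<close> and its reflection.\<close>
    have "P b' a'" using sym[OF d(1,2) ab(2)] a' b' by simp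
    then have "\<not> (i = a \<and> j = b)" "\<not> (i = b' \<and> j = a')" "\<not> ((b = b' \<and> i = a) \<and> j = a')"
      "\<not> ((a = a' \<and> i = b') \<and> j = b)"
      using n ab(2) trans by blast+
    then have "so_root_elt n fring a b r i j = (if j = i then 1 else 0)"
      unfolding so_root_elt_fring[OF ab(1) ij a' b'] by (simp only: if_False) simp
    then show "so_root_elt n fring a b r i j = mone n fring i j"
      using ij by (auto simp: mone_fring)
  qed (rule so_root_elt_in_orth[OF ab(1)])
  have "A \<in> U" if "A \<in> ?S" for A
    using that unfolding root_generated_def
  proof (induction rule: generate.induct)
    case one
    then show ?case by (simp add: U_def)
  next
    case (incl A)
    with root show ?case by (auto simp: so_root_subgroup_def)
  next
    case (inv A)
    then obtain a b r where "(a, b) \<in> so_roots n" "P a b" "A = so_root_elt n fring a b r"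
      by (auto simp: so_root_subgroup_def)
    with root show ?case by (simp add: so_root_elt_inv)
  next
    case (eng A B)
    have "mmul n fring A B i j = mone n fring i j"
      if ij: "i \<in> {1..n}" "j \<in> {1..n}" and n: "\<not> P i j" for i j
    proof -
      have "A i l * B l j = (if l = i then mone n fring i j else 0)" if l: "l \<in> {1..n}" for l
      proof (cases "P i l")
        case True
        then have "\<not> P l j" "l \<noteq> j" "l \<noteq> i" using n trans pos[of i l] by blast+
        then show ?thesis using eng.IH(2) l ij by (simp add: U_def mone_fring)
      next
        case False
        then have "A i l = mone n fring i l" using eng.IH(1) l ij by (simp add: U_def)
        then show ?thesis using eng.IH(2) l ij n by (auto simp add: U_def mone_fring)
      qed
      then have "(\<Sum>l=1..n. A i l * B l j) = (\<Sum>l=1..n. if l = i then mone n fring i j else 0)"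
        by (intro sum.cong refl)
      then show ?thesis using ij by (simp add: mmul_fring)
    qed
    with eng.IH show ?case by (simp add: U_def orth_mmul)
  qed
  then have SU: "?S \<subseteq> U" by blast
  show "lie_alg n ?S \<subseteq> skew n P"
  proof
    fix X assume X: "X \<in> lie_alg n ?S"
    have "?S \<subseteq> orth n" using SU by (auto simp: U_def)
    then have "\<forall>a\<in>{1..n}. \<forall>b\<in>{1..n}. X a b = - X (n + 1 - b) (n + 1 - a)"
      using lie_alg_orth_skew[OF X] by blast
    moreover have "X \<in> mats n fring" using X by (simp add: lie_alg_def)
    moreover have "X a b = 0" if "a \<in> {1..n}" "b \<in> {1..n}" "\<not> P a b" for a b
      by (rule lie_alg_entry_zero[OF X that(1,2)]) (use SU that in \<open>auto simp: U_def\<close>)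
    ultimately show "X \<in> skew n P" by (simp add: skew_def)
  qed
  show "skew_unit n a b \<in> lie_alg n ?S" if ab: "(a, b) \<in> above_antidiag n P" for a b
  proof (rule skew_unit_in_lie_alg)
    show r: "(a, b) \<in> so_roots n" using ab pos[of a b] by (auto simp: above_antidiag_def so_roots_def)
    show "so_root_elt n fring a b t \<in> ?S" for t
      unfolding root_generated_def using r ab
      by (intro generate.incl) (auto simp: above_antidiag_def so_root_subgroup_def)
  qed
qed (fact sym)

section \<open>Counting roots by weights\<close>

text \<open>
  Positions split into those above, on and below the antidiagonal, and reflection exchanges the first
  and the last kind.
\<close>

lemma card_above_antidiag:
  assumes sym: "\<And>a b. a \<in> {1..n} \<Longrightarrow> b \<in> {1..n} \<Longrightarrow> Q a b \<Longrightarrow> Q (n + 1 - b) (n + 1 - a)"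
  shows "2 * card (above_antidiag n Q) + card {a \<in> {1..n}. Q a (n + 1 - a)} =
    card {(a, b). a \<in> {1..n} \<and> b \<in> {1..n} \<and> Q a b}"
proof -
  let ?T = "{(a, b). a \<in> {1..n} \<and> b \<in> {1..n} \<and> Q a b}"
  let ?B = "{(a, b). a \<in> {1..n} \<and> b \<in> {1..n} \<and> n + 2 \<le> a + b \<and> Q a b}"
  let ?D = "{(a, b). a \<in> {1..n} \<and> b \<in> {1..n} \<and> a + b = n + 1 \<and> Q a b}"
  have T: "?T = above_antidiag n Q \<union> (?D \<union> ?B)" unfolding above_antidiag_def by auto
  have fin: "finite ?T" by (rule finite_subset[of _ "{1..n} \<times> {1..n}"]) auto
  then have finDB: "finite ?D" "finite ?B" by (auto elim: rev_finite_subset)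
  have "card ?T = card (above_antidiag n Q) + (card ?D + card ?B)"
  proof -
    have "?D \<inter> ?B = {}" "above_antidiag n Q \<inter> (?D \<union> ?B) = {}"
      unfolding above_antidiag_def by auto
    with finDB show ?thesis unfolding T by (simp add: card_Un_disjoint)
  qed
  moreover have "card ?B = card (above_antidiag n Q)"
  proof -
    have "bij_betw (\<lambda>(a, b). (n + 1 - b, n + 1 - a)) (above_antidiag n Q) ?B"
    proof (rule bij_betw_byWitness[where f' = "\<lambda>(a, b). (n + 1 - b, n + 1 - a)"])
      show "(\<lambda>(a, b). (n + 1 - b, n + 1 - a)) ` above_antidiag n Q \<subseteq> ?B"
      proof (rule image_subsetI, clarify)
        fix a b assume "(a, b) \<in> above_antidiag n Q"
        then have ab: "a \<in> {1..n}" "b \<in> {1..n}" "a + b \<le> n" "Q a b" by (auto simp: above_antidiag_def)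
        then have "n + 1 - b \<in> {1..n}" "n + 1 - a \<in> {1..n}" "n + 2 \<le> n + 1 - b + (n + 1 - a)"
          unfolding atLeastAtMost_iff by linarith+
        with sym[OF ab(1,2,4)] show "n + 1 - b \<in> {1..n} \<and> n + 1 - a \<in> {1..n} \<and>
          n + 2 \<le> n + 1 - b + (n + 1 - a) \<and> Q (n + 1 - b) (n + 1 - a)" by blast
      qed
      show "(\<lambda>(a, b). (n + 1 - b, n + 1 - a)) ` ?B \<subseteq> above_antidiag n Q"
      proof (rule image_subsetI, clarify)
        fix a b assume ab: "a \<in> {1..n}" "b \<in> {1..n}" "n + 2 \<le> a + b" "Q a b"
        then have "n + 1 - b \<in> {1..n}" "n + 1 - a \<in> {1..n}" "n + 1 - b + (n + 1 - a) \<le> n"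
          unfolding atLeastAtMost_iff by linarith+
        with sym[OF ab(1,2,4)] show "(n + 1 - b, n + 1 - a) \<in> above_antidiag n Q"
          unfolding above_antidiag_def by blast
      qed
    qed (auto simp: above_antidiag_def)
    then show ?thesis by (rule bij_betw_same_card[symmetric])
  qed
  moreover have "card ?D = card {a \<in> {1..n}. Q a (n + 1 - a)}"
  proof -
    have "?D = (\<lambda>a. (a, n + 1 - a)) ` {a \<in> {1..n}. Q a (n + 1 - a)}" (is "_ = ?f ` ?A")
    proof (intro equalityI subsetI)
      fix x assume "x \<in> ?D"
      then obtain a b where x: "x = (a, b)" "a \<in> {1..n}" "a + b = n + 1" "Q a b" by blast
      then have "b = n + 1 - a" by linarith
      with x show "x \<in> ?f ` ?A" by blast
    next
      fix x assume "x \<in> ?f ` ?A"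
      then obtain a where a: "x = (a, n + 1 - a)" "a \<in> {1..n}" "Q a (n + 1 - a)" by blast
      then have "n + 1 - a \<in> {1..n}" "a + (n + 1 - a) = n + 1" unfolding atLeastAtMost_iff by linarith+
      with a show "x \<in> ?D" by blast
    qed
    moreover have "inj_on ?f ?A" by (rule inj_onI) simp
    ultimately show ?thesis by (simp only: card_image)
  qed
  ultimately show ?thesis by linarith
qed

text \<open>
  The exponents of \<open>t\<close> in the diagonal matrix \<open>h\<^sub>\<O>(t)\<close>, before they are sorted.
\<close>

definition weights :: "nat multiset \<Rightarrow> int multiset" where
  "weights \<O> = (\<Sum>p\<in>#\<O>. mset (map (\<lambda>j. int p - 1 - 2 * int j) [0..<p]))"

lemma hexp_weights: "hexp \<O> a = rev (sorted_list_of_multiset (weights \<O>)) ! (a - 1)"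
  by (simp add: hexp_def weights_def)

lemma weights_add [simp]: "weights (\<O> + \<O>') = weights \<O> + weights \<O>'"
  by (simp add: weights_def)

lemma size_weights: "size (weights \<O>) = sum_mset \<O>"
  unfolding weights_def by (induction \<O>) auto

lemma weights_uminus: "image_mset uminus (weights \<O>) = weights \<O>"
proof -
  have "image_mset uminus (mset (map (\<lambda>j. int p - 1 - 2 * int j) [0..<p])) =
    mset (map (\<lambda>j. int p - 1 - 2 * int j) [0..<p])" for p
  proof -
    have "map uminus (map (\<lambda>j. int p - 1 - 2 * int j) [0..<p]) =
      rev (map (\<lambda>j. int p - 1 - 2 * int j) [0..<p])"
      by (rule nth_equalityI) (auto simp: rev_nth)
    then show ?thesis by (metis mset_map mset_rev)
  qed
  then show ?thesis unfolding weights_def by (induction \<O>) auto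
qed

lemma sum_hexp:
  assumes "sum_mset \<O> = n"
  shows "(\<Sum>a=1..n. g (hexp \<O> a)) = (\<Sum>x\<in>#weights \<O>. g x :: nat)"
proof -
  let ?L = "rev (sorted_list_of_multiset (weights \<O>))"
  have len: "length ?L = n" using assms by (simp add: size_weights flip: size_mset)
  have "(\<Sum>a=1..n. g (hexp \<O> a)) = (\<Sum>i<n. g (?L ! i))"
    unfolding hexp_weights by (rule sum.reindex_bij_witness[of _ Suc "\<lambda>a. a - 1"]) auto
  also have "\<dots> = sum_list (map g ?L)"
    using len by (simp add: sum_list_sum_nth atLeast0LessThan)
  also have "\<dots> = (\<Sum>x\<in>#mset ?L. g x)" by (metis mset_map sum_mset_sum_list)
  finally show ?thesis by simp
qed

text \<open>
  The weights are symmetric about \<open>0\<close>, so negating the decreasing list of weights reverses it.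
\<close>

lemma hexp_uminus:
  assumes "sum_mset \<O> = n" "a \<in> {1..n}"
  shows "hexp \<O> (n + 1 - a) = - hexp \<O> a"
proof -
  let ?S = "sorted_list_of_multiset (weights \<O>)"
  have len: "length ?S = n" using assms by (simp add: size_weights flip: size_mset)
  have "sorted (map uminus (rev ?S))"
    by (simp add: rev_map[symmetric] sorted_wrt_rev sorted_wrt_map)
  moreover have "mset (map uminus (rev ?S)) = mset ?S"
    by (simp add: weights_uminus)
  ultimately have eq: "map uminus (rev ?S) = ?S"
    by (metis properties_for_sort sorted_sorted_list_of_multiset sorted_sort_id)
  have "rev ?S ! (n + 1 - a - 1) = ?S ! (a - 1)"
    using assms(2) len by (simp add: rev_nth)
  also have "\<dots> = map uminus (rev ?S) ! (a - 1)" by (simp only: eq)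
  also have "\<dots> = - (rev ?S ! (a - 1))" using assms(2) len by (subst nth_map) auto
  finally show ?thesis unfolding hexp_weights .
qed

lemma hexp_antimono:
  assumes "sum_mset \<O> = n" "1 \<le> a" "a \<le> b" "b \<le> n"
  shows "hexp \<O> b \<le> hexp \<O> a"
proof -
  let ?S = "sorted_list_of_multiset (weights \<O>)"
  have len: "length ?S = n" using assms by (simp add: size_weights flip: size_mset)
  show ?thesis unfolding hexp_weights
    by (rule sorted_rev_nth_mono) (use assms len in auto)
qed

definition pairs_apart :: "int \<Rightarrow> int multiset \<Rightarrow> int multiset \<Rightarrow> nat" where
  "pairs_apart c A B = (\<Sum>x\<in>#A. \<Sum>y\<in>#B. if c \<le> x - y then 1 else 0)"

text \<open>
  The roots of \<open>V\<^sub>c\<close> are the positions \<open>(a, b)\<close> whose weights differ by at least \<open>c\<close>.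
  Counting all positions counts each root twice and also counts the antidiagonal positions,
  where the difference is twice a weight.
\<close>

lemma alg_dim_Vgrp:
  fixes \<O> :: "nat multiset"
  assumes n: "sum_mset \<O> = n" and c: "1 \<le> c"
  shows "2 * alg_dim n (Vgrp n (fring :: 'k::field_char_0 ring) c \<O>)
    + (\<Sum>x\<in>#weights \<O>. if c \<le> 2 * x then 1 else 0) = pairs_apart c (weights \<O>) (weights \<O>)"
proof -
  let ?P = "Vcond \<O> c"
  have P: "?P a b \<longleftrightarrow> c \<le> hexp \<O> a - hexp \<O> b" if "a \<in> {1..n}" "b \<in> {1..n}" for a b
    using hexp_antimono[OF n, of b a] that c unfolding Vcond_def atLeastAtMost_iff by (cases "b \<le> a") auto
  have sym: "?P (n + 1 - b) (n + 1 - a)" if "a \<in> {1..n}" "b \<in> {1..n}" "?P a b" for a b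
  proof -
    have "n + 1 - b < n + 1 - a" using that unfolding Vcond_def atLeastAtMost_iff by linarith
    with that show ?thesis unfolding Vcond_def by (simp only: hexp_uminus[OF n]) simp
  qed
  have "alg_dim n (Vgrp n (fring :: 'k ring) c \<O>) = card (above_antidiag n ?P)"
    unfolding Vgrp_def
  proof (rule alg_dim_root_generated)
    show "a < b" if "?P a b" for a b using that by (simp add: Vcond_def)
    show "?P a d" if "?P a b" "?P b d" for a b d using that c by (simp add: Vcond_def)
  qed (fact sym)
  moreover have "card {a \<in> {1..n}. ?P a (n + 1 - a)} = (\<Sum>x\<in>#weights \<O>. if c \<le> 2 * x then 1 else 0)"
  proof -
    have "?P a (n + 1 - a) \<longleftrightarrow> c \<le> 2 * hexp \<O> a" if a: "a \<in> {1..n}" for a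
    proof -
      have "n + 1 - a \<in> {1..n}" using a unfolding atLeastAtMost_iff by linarith
      from P[OF a this] show ?thesis unfolding hexp_uminus[OF n a] by simp
    qed
    then have "card {a \<in> {1..n}. ?P a (n + 1 - a)} = card {a \<in> {1..n}. c \<le> 2 * hexp \<O> a}"
      by (intro arg_cong[of _ _ card]) blast
    also have "\<dots> = (\<Sum>a=1..n. if c \<le> 2 * hexp \<O> a then 1 else 0)"
      by (simp add: sum.If_cases Int_def)
    finally show ?thesis unfolding sum_hexp[OF n, of "\<lambda>x. if c \<le> 2 * x then 1 else 0"] .
  qed
  moreover have "card {(a, b). a \<in> {1..n} \<and> b \<in> {1..n} \<and> ?P a b} = pairs_apart c (weights \<O>) (weights \<O>)"
  proof -
    have "{(a, b). a \<in> {1..n} \<and> b \<in> {1..n} \<and> ?P a b} =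
      (SIGMA a:{1..n}. {b \<in> {1..n}. c \<le> hexp \<O> a - hexp \<O> b})"
      using P by auto
    also have "card \<dots> = (\<Sum>a=1..n. card {b \<in> {1..n}. c \<le> hexp \<O> a - hexp \<O> b})"
      by (rule card_SigmaI) auto
    also have "\<dots> = (\<Sum>a=1..n. \<Sum>b=1..n. if c \<le> hexp \<O> a - hexp \<O> b then 1 else 0)"
      by (simp add: sum.If_cases Int_def)
    also have "\<dots> = (\<Sum>a=1..n. \<Sum>y\<in>#weights \<O>. if c \<le> hexp \<O> a - y then 1 else 0)"
      by (rule sum.cong[OF refl]) (rule sum_hexp[OF n])
    also have "\<dots> = pairs_apart c (weights \<O>) (weights \<O>)"
      unfolding pairs_apart_def by (rule sum_hexp[OF n])
    finally show ?thesis .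
  qed
  ultimately show ?thesis using card_above_antidiag[of n ?P, OF sym] by simp
qed

lemma dim_SO_double: "2 * dim_SO TYPE('f::field_char_0) n + n = n * n"
proof -
  have "{(a, b). a \<in> {1..n} \<and> b \<in> {1..n} \<and> True} = {1..n} \<times> {1..n}" by auto
  then have "card {(a, b). a \<in> {1..n} \<and> b \<in> {1..n} \<and> True} = n * n"
    by (simp only: card_cartesian_product) simp
  moreover have "card {a \<in> {1..n}. True} = n"
    by (simp only: simp_thms Collect_mem_eq card_atLeastAtMost)
  ultimately show ?thesis
    using card_above_antidiag[of n "\<lambda>_ _. True"] unfolding dim_SO_def alg_dim_SO by linarith
qed

section \<open>Orbits with odd parts and their lifts\<close>

lemma pairs_apart_add [simp]:
  "pairs_apart c (A + A') B = pairs_apart c A B + pairs_apart c A' B"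
  "pairs_apart c A (B + B') = pairs_apart c A B + pairs_apart c A B'"
  by (simp_all add: pairs_apart_def sum_mset.distrib)

lemma pairs_apart_all:
  assumes "\<And>x y. x \<in># A \<Longrightarrow> y \<in># B \<Longrightarrow> c \<le> x - y"
  shows "pairs_apart c A B = size A * size B"
proof -
  have "pairs_apart c A B = (\<Sum>x\<in>#A. \<Sum>y\<in>#B. 1)"
    unfolding pairs_apart_def
    by (intro arg_cong[of _ _ sum_mset] image_mset_cong) (use assms in auto)
  then show ?thesis by (simp add: sum_mset_constant)
qed

lemma pairs_apart_none:
  assumes "\<And>x y. x \<in># A \<Longrightarrow> y \<in># B \<Longrightarrow> x - y < c"
  shows "pairs_apart c A B = 0"
proof -
  have "\<not> c \<le> x - y" if "x \<in># A" "y \<in># B" for x y using assms[OF that] by simp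
  then have "pairs_apart c A B = (\<Sum>x\<in>#A. \<Sum>y\<in>#B. 0)"
    unfolding pairs_apart_def
    by (intro arg_cong[of _ _ sum_mset] image_mset_cong) simp
  then show ?thesis by simp
qed

lemma pairs_apart_shift: "pairs_apart c (image_mset ((+) d) A) (image_mset ((+) d) B) = pairs_apart c A B"
  by (simp add: pairs_apart_def multiset.map_comp o_def)

lemma pairs_apart_uminus: "pairs_apart c (image_mset uminus A) (image_mset uminus A) = pairs_apart c A A"
proof -
  have "pairs_apart c (image_mset uminus A) (image_mset uminus A) = (\<Sum>x\<in>#A. \<Sum>y\<in>#A. if c \<le> y - x then 1 else 0)"
    by (simp add: pairs_apart_def multiset.map_comp o_def)
  also have "\<dots> = pairs_apart c A A"
    unfolding pairs_apart_def by (rule sum_mset.swap)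
  finally show ?thesis .
qed

text \<open>
  An odd part \<open>p = 2 m + 1\<close> has the weights \<open>2, 4, \<dots>, 2 m\<close>, their negatives, and \<open>0\<close> once.
\<close>

definition positive_weights :: "nat multiset \<Rightarrow> int multiset" where
  "positive_weights \<O> = (\<Sum>p\<in>#\<O>. mset (map (\<lambda>j. 2 * int j + 2) [0..<p div 2]))"

lemma weights_of_odd_part:
  "mset (map (\<lambda>j. int (2 * m + 1) - 1 - 2 * int j) [0..<2 * m + 1]) =
    mset (map (\<lambda>j. 2 * int j + 2) [0..<m]) + {#0#} + image_mset uminus (mset (map (\<lambda>j. 2 * int j + 2) [0..<m]))"
proof (induction m)
  case (Suc m)
  let ?w = "\<lambda>m j. int (2 * m + 1) - 1 - 2 * int j"
  have "[0..<2 * Suc m + 1] = [0..<2 * m + 2] @ [2 * m + 2]" by simp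
  also have "[0..<2 * m + 2] = 0 # map Suc [0..<2 * m + 1]"
    by (simp add: map_Suc_upt upt_conv_Cons del: upt_Suc)
  finally have "mset (map (?w (Suc m)) [0..<2 * Suc m + 1]) =
    {#2 * int m + 2#} + mset (map (?w m) [0..<2 * m + 1]) + {#- (2 * int m + 2)#}"
    by (simp add: o_def algebra_simps del: upt_Suc mset_upt)
  then show ?case unfolding Suc.IH by (simp add: algebra_simps del: mset_upt)
qed simp

lemma weights_odd:
  assumes "\<And>p. p \<in># \<O> \<Longrightarrow> odd p"
  shows "weights \<O> = positive_weights \<O> + replicate_mset (size \<O>) 0 + image_mset uminus (positive_weights \<O>)"
  using assms
proof (induction \<O>)
  case (add p \<O>)
  from add.prems[of p] obtain m where "p = 2 * m + 1" by (auto elim: oddE)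
  with weights_of_odd_part[of m] add show ?case
    by (simp add: weights_def positive_weights_def del: upt_Suc)
qed (simp add: weights_def positive_weights_def)

lemma positive_weights_ge_2: "x \<in># positive_weights \<O> \<Longrightarrow> 2 \<le> x"
  unfolding positive_weights_def by (induction \<O>) auto

lemma positive_weights_even: "x \<in># positive_weights \<O> \<Longrightarrow> even x"
  unfolding positive_weights_def by (induction \<O>) auto

text \<open>
  Enlarging an odd part by \<open>2\<close> prolongs its chain of positive weights \<open>2, 4, \<dots>, 2 m\<close> to
  \<open>2, 4, \<dots>, 2 m + 2\<close>, which is the old chain together with the old weight \<open>0\<close>, shifted
  by \<open>2\<close>. The extra part \<open>1\<close> only contributes the weight \<open>0\<close>.
\<close>

lemma positive_weights_lift:
  "positive_weights (image_mset (\<lambda>p. p + 2) \<O> + {#1#}) =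
    image_mset ((+) 2) (positive_weights \<O> + replicate_mset (size \<O>) 0)"
proof (induction \<O>)
  case (add p \<O>)
  let ?f = "\<lambda>j. 2 * int j + 2"
  have "[0..<(p + 2) div 2] = 0 # map Suc [0..<p div 2]"
    by (simp add: map_Suc_upt upt_conv_Cons del: upt_Suc)
  then have "map ?f [0..<(p + 2) div 2] = map ((+) 2) (0 # map ?f [0..<p div 2])"
    by (simp add: o_def del: upt_Suc)
  then have "mset (map ?f [0..<(p + 2) div 2]) = image_mset ((+) 2) (mset (0 # map ?f [0..<p div 2]))"
    by (simp only: mset_map)
  also have "mset (0 # map ?f [0..<p div 2]) = mset (map ?f [0..<p div 2]) + {#0#}"
    by (simp del: mset_upt)
  finally have part: "mset (map ?f [0..<(p + 2) div 2]) = image_mset ((+) 2) (mset (map ?f [0..<p div 2]) + {#0#})" .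
  have "positive_weights (image_mset (\<lambda>p. p + 2) (add_mset p \<O>) + {#1#}) =
    mset (map ?f [0..<(p + 2) div 2]) + positive_weights (image_mset (\<lambda>p. p + 2) \<O> + {#1#})"
    by (simp add: positive_weights_def del: mset_upt)
  also have "\<dots> = image_mset ((+) 2) (mset (map ?f [0..<p div 2]) + {#0#})
      + image_mset ((+) 2) (positive_weights \<O> + replicate_mset (size \<O>) 0)"
    by (simp only: part add)
  also have "\<dots> = image_mset ((+) 2) (positive_weights (add_mset p \<O>) + replicate_mset (size (add_mset p \<O>)) 0)"
    by (simp add: positive_weights_def del: mset_upt)
  finally show ?case .
qed (simp add: positive_weights_def)

text \<open>
  The ordered pairs within \<open>P\<close> and within \<open>- P\<close> are equally many; elements of \<open>P\<close> exceed \<open>0\<close>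
  and elements of \<open>- P\<close>, and \<open>0\<close> exceeds elements of \<open>- P\<close>.
\<close>

lemma pairs_apart_symmetric:
  assumes "\<And>x. x \<in># P \<Longrightarrow> c \<le> x" "0 < c"
    and W: "W = P + replicate_mset z 0 + image_mset uminus P"
  shows "pairs_apart c W W = 2 * pairs_apart c P P + 2 * size P * z + size P * size P"
proof -
  let ?Z = "replicate_mset z (0 :: int)" and ?N = "image_mset uminus P"
  have Z: "x = 0" if "x \<in># ?Z" for x using that by (simp split: if_splits)
  have N: "x \<le> - c" if "x \<in># ?N" for x using that assms(1) by force
  have "pairs_apart c P ?Z = size P * size ?Z"
    by (rule pairs_apart_all, drule assms(1), drule Z, simp)
  moreover have "pairs_apart c ?Z ?N = size ?Z * size ?N"
    by (rule pairs_apart_all, drule Z, drule N, simp)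
  moreover have "pairs_apart c P ?N = size P * size ?N"
    by (rule pairs_apart_all, drule assms(1), drule N) (use assms(2) in linarith)
  moreover have "pairs_apart c ?Z P = 0"
    by (rule pairs_apart_none, drule Z, drule assms(1)) (use assms(2) in linarith)
  moreover have "pairs_apart c ?Z ?Z = 0"
    by (rule pairs_apart_none, drule Z, drule Z) (use assms(2) in linarith)
  moreover have "pairs_apart c ?N P = 0"
    by (rule pairs_apart_none, drule N, drule assms(1)) (use assms(2) in linarith)
  moreover have "pairs_apart c ?N ?Z = 0"
    by (rule pairs_apart_none, drule N, drule Z) (use assms(2) in linarith)
  ultimately show ?thesis unfolding W by (simp add: pairs_apart_uminus)
qed

text \<open>
  All weights are even, so differences at least \<open>1\<close> are at least \<open>2\<close>, and the groups
  \<open>V\<^sub>1\<close> and \<open>V\<^sub>2\<close> have the same dimension.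
\<close>

lemma alg_dim_Vgrp_odd:
  assumes odd: "\<And>p. p \<in># \<O> \<Longrightarrow> odd p" and n: "sum_mset \<O> = n" and c: "c \<in> {1, 2}"
  defines "P \<equiv> positive_weights \<O>"
  shows "2 * alg_dim n (Vgrp n (fring :: 'k::field_char_0 ring) c \<O>) + size P =
     2 * pairs_apart 2 P P + 2 * size P * size \<O> + size P * size P"
    and "n = 2 * size P + size \<O>"
proof -
  let ?W = "weights \<O>"
  have W: "?W = P + replicate_mset (size \<O>) 0 + image_mset uminus P"
    unfolding P_def by (rule weights_odd[OF odd])
  show "n = 2 * size P + size \<O>"
    using size_weights[of \<O>] unfolding n W by simp
  have ev: "even x" if "x \<in># ?W" for x
    using that unfolding W P_def by (auto dest: positive_weights_even split: if_splits)
  have "c \<le> x - y \<longleftrightarrow> 2 \<le> x - y" if "x \<in># ?W" "y \<in># ?W" for x y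
  proof -
    have "c = 1 \<or> c = 2" using c by simp
    with ev[OF that(1)] ev[OF that(2)] show ?thesis by presburger
  qed
  then have "pairs_apart c ?W ?W = pairs_apart 2 ?W ?W"
    unfolding pairs_apart_def
    by (intro arg_cong[of _ _ sum_mset] image_mset_cong if_cong) auto
  moreover have "pairs_apart 2 ?W ?W = 2 * pairs_apart 2 P P + 2 * size P * size \<O> + size P * size P"
    by (rule pairs_apart_symmetric[OF _ _ W]) (use positive_weights_ge_2 in \<open>auto simp: P_def\<close>)
  moreover have "(\<Sum>x\<in>#?W. if c \<le> 2 * x then 1 else 0) = size P"
  proof -
    have "(\<Sum>x\<in>#P. if c \<le> 2 * x then 1 else 0) = (\<Sum>x\<in>#P. 1 :: nat)"
      by (intro arg_cong[of _ _ sum_mset] image_mset_cong)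
        (use positive_weights_ge_2[of _ \<O>] c in \<open>force simp: P_def\<close>)
    moreover have "(\<Sum>x\<in>#image_mset uminus P. if c \<le> 2 * x then 1 else 0) = (\<Sum>x\<in>#image_mset uminus P. 0 :: nat)"
      by (intro arg_cong[of _ _ sum_mset] image_mset_cong)
        (use positive_weights_ge_2[of _ \<O>] c in \<open>force simp: P_def\<close>)
    ultimately show ?thesis using c unfolding W by auto
  qed
  ultimately show "2 * alg_dim n (Vgrp n (fring :: 'k::field_char_0 ring) c \<O>) + size P =
     2 * pairs_apart 2 P P + 2 * size P * size \<O> + size P * size P"
    using alg_dim_Vgrp[OF n, of c, where 'k = 'k] c by auto
qed

text \<open>
  The weights are \<open>1\<close> and \<open>- 1\<close>, each \<open>m\<close> times, and \<open>0\<close> once.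
\<close>

lemma alg_dim_Vgrp_theta:
  fixes m :: nat
  defines "\<T> \<equiv> replicate_mset m 2 + {#1#}"
  shows "2 * alg_dim (2 * m + 1) (Vgrp (2 * m + 1) (fring :: 'k::field_char_0 ring) 1 \<T>) = m * m + m"
    and "2 * alg_dim (2 * m + 1) (Vgrp (2 * m + 1) (fring :: 'k ring) 2 \<T>) + m = m * m"
proof -
  have n: "sum_mset \<T> = 2 * m + 1" by (simp add: \<T>_def)
  have "mset (map (\<lambda>j. int 2 - 1 - 2 * int j) [0..<2]) = {#1, - 1#}"
    by (simp add: upt_rec del: mset_upt)
  then have w2: "weights (add_mset 2 A) = {#1, - 1#} + weights A" for A
    by (simp only: weights_def image_mset_add_mset sum_mset.add_mset)
  have w1: "weights {#1#} = {#0#}" by (simp add: weights_def)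
  have "weights (replicate_mset m 2) = replicate_mset m 1 + replicate_mset m (- 1)"
    by (induction m) (simp_all add: w2 weights_def[of "{#}"])
  then have W: "weights \<T> = replicate_mset m 1 + {#0#} + replicate_mset m (- 1)"
    unfolding \<T>_def weights_add w1 by simp
  have "pairs_apart 1 (weights \<T>) (weights \<T>) = m * m + 2 * m"
    "pairs_apart 2 (weights \<T>) (weights \<T>) = m * m"
    unfolding W pairs_apart_def by simp_all
  with alg_dim_Vgrp[OF n, of 1, where 'k = 'k] alg_dim_Vgrp[OF n, of 2, where 'k = 'k]
  show "2 * alg_dim (2 * m + 1) (Vgrp (2 * m + 1) (fring :: 'k::field_char_0 ring) 1 \<T>) = m * m + m"
    "2 * alg_dim (2 * m + 1) (Vgrp (2 * m + 1) (fring :: 'k ring) 2 \<T>) + m = m * m"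
    unfolding W by simp_all
qed

section \<open>The dimension identity\<close>

lemma gk_dim_odd:
  fixes C :: "('f::field_char_0, 'g) metacover"
  assumes wf: "wave_front_set C \<rho> = {\<O>}" and C: "mc_deg C = n"
    and odd: "\<And>p. p \<in># \<O> \<Longrightarrow> odd p" and n: "sum_mset \<O> = n"
  defines "P \<equiv> positive_weights \<O>"
  shows "2 * gk_dim C \<rho> + size P =
     2 * pairs_apart 2 P P + 2 * size P * size \<O> + size P * size P"
proof -
  let ?d = "\<lambda>i. alg_dim n (Vgrp n (fring :: 'f alg_closure ring) i \<O>)"
  have "gk_dim C \<rho> = real (?d 2) + (real (?d 1) - real (?d 2)) / 2"
    by (simp add: gk_dim_def wf C Let_def)
  moreover have d: "2 * ?d c + size P = 2 * pairs_apart 2 P P + 2 * size P * size \<O> + size P * size P"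
    if "c \<in> {1, 2}" for c
    unfolding P_def by (rule alg_dim_Vgrp_odd(1)[OF odd n that])
  moreover have "?d 1 = ?d 2" using d[of 1] d[of 2] by simp
  moreover have "2 * real (?d 2) + real (size P) =
      2 * real (pairs_apart 2 P P) + 2 * real (size P) * real (size \<O>) + real (size P) * real (size P)"
    using arg_cong[OF d[of 2], of real] unfolding of_nat_add of_nat_mult of_nat_numeral by blast
  ultimately show ?thesis by simp
qed

lemma gk_dim_theta:
  fixes C :: "('f::field_char_0, 'g) metacover"
  assumes wf: "wave_front_set C \<rho> = {theta_orbit m}" and C: "mc_deg C = 2 * m + 1" and m: "even m"
  shows "2 * gk_dim C \<rho> = real m * real m"
proof -
  let ?T = "replicate_mset m 2 + {#1#} :: nat multiset"
  let ?d = "\<lambda>i. alg_dim (2 * m + 1) (Vgrp (2 * m + 1) (fring :: 'f alg_closure ring) i ?T)"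
  have "gk_dim C \<rho> = real (?d 2) + (real (?d 1) - real (?d 2)) / 2"
    using m by (simp add: gk_dim_def wf C Let_def theta_orbit_def)
  then have "4 * gk_dim C \<rho> = real (2 * ?d 1) + real (2 * ?d 2)" by (simp add: field_simps)
  moreover have "real (2 * ?d 1) = real (m * m + m)" "real (2 * ?d 2 + m) = real (m * m)"
    using alg_dim_Vgrp_theta[of m, where 'k = "'f alg_closure"] by (simp_all only:)
  ultimately show ?thesis by simp
qed

lemma sum_replicate_mset:
  fixes f :: "'a \<Rightarrow> 'b"
  shows "size (\<Sum>i\<in>A. replicate_mset (r i) (f i)) = (\<Sum>i\<in>A. r i)"
    and "image_mset g (\<Sum>i\<in>A. replicate_mset (r i) (f i)) = (\<Sum>i\<in>A. replicate_mset (r i) (g (f i)))"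
    and "x \<in># (\<Sum>i\<in>A. replicate_mset (r i) (f i)) \<Longrightarrow> x \<in> f ` A"
  by (induction A rule: infinite_finite_induct) (auto split: if_splits)

text \<open>
  Let \<open>P\<close> be the \<open>s\<close> positive weights of \<open>\<O>\<close>, let \<open>l\<close> be its number of parts, and let
  \<open>g\<close> count the pairs in \<open>P\<close> with positive difference. Then \<open>n = 2 s + l\<close>, and
  \<open>2 g + 2 s l + s\<^sup>2 - s\<close> is twice the dimension for \<open>\<O>\<close>. Passing to the lifted orbit replaces
  \<open>g, s, l\<close> by \<open>g + s l, s + l, l + 1\<close>, so \<open>g\<close> cancels from the identity and a polynomial
  identity in \<open>s\<close> and \<open>l\<close> remains. The number \<open>l\<close> has the parity of \<open>n\<close>, hence is odd, and
  \<open>n + l\<close> is even; this selects the orbit of the theta representation.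
\<close>

lemma gk_dim_identity:
  fixes \<O> :: "nat multiset"
    and C_even :: "('f::field_char_0, 'g1) metacover" and C_odd :: "('f, 'g2) metacover"
    and C_big :: "('f, 'g3) metacover"
  assumes odd: "\<And>p. p \<in># \<O> \<Longrightarrow> odd p" and n: "sum_mset \<O> = n" "odd n"
    and deg: "mc_deg C_odd = n" "mc_deg C_even = n + 2 * size \<O> + 1"
      "mc_deg C_big = 2 * (n + size \<O>) + 1"
    and wf: "wave_front_set C_odd \<pi> = {\<O>}"
      "wave_front_set C_even \<sigma> = {image_mset (\<lambda>p. p + 2) \<O> + {#1#}}"
      "wave_front_set C_big \<theta> = {theta_orbit (n + size \<O>)}"
  shows "dim_SO TYPE('f) n + gk_dim C_even \<sigma> = gk_dim C_odd \<pi> + gk_dim C_big \<theta>"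
proof -
  define l P \<O>' P' where "l = size \<O>" and "P = positive_weights \<O>"
    and "\<O>' = image_mset (\<lambda>p. p + 2) \<O> + {#1#}" and "P' = positive_weights \<O>'"
  define s g where "s = size P" and "g = pairs_apart 2 P P"
  have n_eq: "n = 2 * s + l"
    unfolding s_def l_def P_def using alg_dim_Vgrp_odd(2)[OF odd n(1), of 1] by simp
  have P': "P' = image_mset ((+) 2) (P + replicate_mset l 0)"
    unfolding P'_def \<O>'_def P_def l_def by (rule positive_weights_lift)
  then have size: "size P' = s + l" by (simp add: s_def)
  have pairs: "pairs_apart 2 P' P' = g + s * l"
  proof -
    let ?Z = "replicate_mset l (0 :: int)"
    have Z: "x = 0" if "x \<in># ?Z" for x using that by (simp split: if_splits)
    have P: "2 \<le> x" if "x \<in># P" for x using that positive_weights_ge_2 by (simp add: P_def)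
    have "pairs_apart 2 P ?Z = size P * size ?Z"
      by (rule pairs_apart_all, drule P, drule Z, simp)
    moreover have "pairs_apart 2 ?Z P = 0"
      by (rule pairs_apart_none, drule Z, drule P, simp)
    moreover have "pairs_apart 2 ?Z ?Z = 0"
      by (rule pairs_apart_none, drule Z, drule Z, simp)
    ultimately show ?thesis unfolding P' pairs_apart_shift by (simp add: g_def s_def)
  qed
  have odd': "odd p" if "p \<in># \<O>'" for p using that odd by (auto simp: \<O>'_def)
  have "sum_mset (image_mset (\<lambda>p. p + 2) \<O>) = n + 2 * size \<O>"
    unfolding n(1)[symmetric] by (induction \<O>) auto
  then have sum': "sum_mset \<O>' = n + 2 * size \<O> + 1" by (simp add: \<O>'_def)
  have size': "size \<O>' = l + 1" by (simp add: \<O>'_def l_def)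
  have "2 * gk_dim C_odd \<pi> + s = 2 * g + 2 * s * l + s * s"
    using gk_dim_odd[OF wf(1) deg(1) odd n(1)] by (simp only: s_def g_def l_def P_def)
  moreover have "2 * gk_dim C_even \<sigma> + (s + l) = 2 * (g + s * l) + 2 * (s + l) * (l + 1) + (s + l) * (s + l)"
    using gk_dim_odd[OF wf(2)[folded \<O>'_def] deg(2) odd' sum']
    by (simp only: size' P'_def[symmetric] size pairs)
  moreover have "2 * gk_dim C_big \<theta> = real (n + l) * real (n + l)"
  proof -
    have "even (n + l)" using n(2) n_eq by simp
    then show ?thesis using gk_dim_theta[OF wf(3) deg(3)] by (simp only: l_def)
  qed
  moreover have "2 * real (dim_SO TYPE('f) n) + real n = real n * real n"
    using arg_cong[OF dim_SO_double[of n, where 'f = 'f], of real] by simp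
  ultimately show ?thesis unfolding n_eq by (simp add: algebra_simps)
qed

theorem proposition4p9:
  fixes c :: "('f::field_char_0 \<Rightarrow> real) \<Rightarrow> (nat \<Rightarrow> 'f) set \<Rightarrow> (nat \<Rightarrow> 'f) set \<Rightarrow> 'f"
    and C_even C_odd C_big :: "('f, 'g) metacover"
    and \<iota> :: "'g \<Rightarrow> 'g \<Rightarrow> 'g"
    and k l p :: nat
    and n r :: "nat \<Rightarrow> nat"
    and \<O> \<O>' :: "nat multiset"
    and \<V> :: "('g \<Rightarrow> complex) set"
  defines "\<O> \<equiv> (\<Sum>i=1..p. replicate_mset (r i) (2 * n i + 1))"
    and "\<O>' \<equiv> (\<Sum>i=1..p. replicate_mset (r i) (2 * n i + 3)) + {#1#}"
    and "l \<equiv> (\<Sum>i=1..p. r i)"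
  assumes F: "number_field TYPE('f)" "card (mu4 :: 'f set) = 4" "hilbert_symbols c"
    and covers:
      "so_double_cover c C_odd" "mc_deg C_odd = 2 * k + 1"
      "so_double_cover c C_even" "mc_deg C_even = 2 * k + 2 * l + 2"
      "so_double_cover c C_big" "mc_deg C_big = 4 * k + 2 * l + 3"
      "cover_embedding C_even C_odd C_big \<iota>"
    and parts: "\<And>i j. 1 \<le> i \<Longrightarrow> i < j \<Longrightarrow> j \<le> p \<Longrightarrow> n i > n j" "\<And>i. i \<in> {1..p} \<Longrightarrow> r i > 0"
    and orbit: "is_orbit (2 * k + 1) \<O>"
    and pi: "automorphic_rep C_odd \<V>" "irreducible_rep C_odd \<V>" "cuspidal_rep C_odd \<V>"
      "genuine_rep C_odd \<V>"
    and wf_pi: "wave_front_set C_odd \<V> = {\<O>}"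
    and wf_lift: "wave_front_set C_even (theta_lift C_even C_odd C_big \<iota> \<V>) = {\<O>'}"
    and wf_theta: "wave_front_set C_big (theta_rep C_big) = {theta_orbit (2 * k + l + 1)}"
  shows "real (dim_SO TYPE('f) (2 * k + 1)) + gk_dim C_even (theta_lift C_even C_odd C_big \<iota> \<V>)
           = gk_dim C_odd \<V> + gk_dim C_big (theta_rep C_big)"
proof -
  have size: "size \<O> = l"
    unfolding \<O>_def l_def by (rule sum_replicate_mset(1))
  have lift: "\<O>' = image_mset (\<lambda>p. p + 2) \<O> + {#1#}"
    unfolding \<O>_def \<O>'_def sum_replicate_mset(2) by (simp add: numeral_3_eq_3)
  have odd: "odd q" if "q \<in># \<O>" for q
    using sum_replicate_mset(3)[OF that[unfolded \<O>_def]] by auto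
  have sum: "sum_mset \<O> = 2 * k + 1" using orbit by (simp add: is_orbit_def)
  have "mc_deg C_even = 2 * k + 1 + 2 * size \<O> + 1" "mc_deg C_big = 2 * (2 * k + 1 + size \<O>) + 1"
    using covers by (simp_all add: size)
  moreover have "wave_front_set C_big (theta_rep C_big) = {theta_orbit (2 * k + 1 + size \<O>)}"
    using wf_theta by (simp add: size)
  ultimately show ?thesis
    using gk_dim_identity[OF odd sum _ covers(2) _ _ wf_pi wf_lift[unfolded lift]] by simp
qed

end
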